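(* For each $n \ge 1$, let $f_n$ be the fraction, among all $(n+1)!\,C_n^2$ fully marked tree pair diagrams of size $n$, of those diagrams whose associated element of Thompson's group $V$ has north-south dynamics as a (piecewise continuous) bijection of the circle $S^1$. Then the limit $\lim_{n\to\infty} f_n$ exists and is positive.
   Context: Trees are finite rooted binary trees in which every internal node has an ordered left child and right child. A tree has size $n$ if it has $n$ internal nodes; it then has $n+1$ leaves, numbered $0,\dots,n$ from left to right, and the number of trees of size $n$ is the Catalan number $C_n=\frac{1}{n+1}\binom{2n}{n}$. A tree determines a subdivision of $[0,1)$ into half-open dyadic intervals, one per leaf: the root corresponds to $[0,1)$, and if a node corresponds to $[a,b)$ then its left and right children correspond to $[a,\frac{a+b}{2})$ and $[\frac{a+b}{2},b)$. Identify $S^1$ with $[0,1)$, i.e. with $\mathbb{R}/\mathbb{Z}$. Thompson's group $V$ is the group of right-continuous piecewise-linear bijections of $S^1=\mathbb{R}/\mathbb{Z}$ which map dyadic rationals to dyadic rationals, whose slopes, where defined, are powers of $2$, and whose (finitely many) breakpoints and discontinuities lie in the dyadic rationals $\mathbb{Z}[\frac12]$. A fully marked tree pair diagram of size $n$ is a triple $(S,R,\pi)$ where $S$ (source) and $R$ (target) are trees of size $n$ and $\pi$ is a bijection from the leaves of $S$ to the leaves of $R$. The associated element of $V$ maps the interval of each leaf of $S$ onto the interval of the corresponding leaf of $R$ by the increasing affine map. Diagrams are not required to be reduced; all diagrams are counted, so the same element of $V$ may be represented by many diagrams, of the same or different sizes. A bijection $g$ of the circle (not necessarily continuous) has north-south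 dynamics if it has exactly two fixed points, one of which is attracting for positive iterates of $g$ and the other of which is attracting for positive iterates of $g^{-1}$. (A fixed point $p$ is attracting for positive iterates of $h$ if $p$ has a neighborhood $U$ in $S^1$ such that $h^m(x)\to p$ as $m\to\infty$ for all $x\in U$.) *)

theory Defs
  imports "HOL-Analysis.Analysis" "HOL-Library.Tree"
begin

section \<open>Trees and dyadic subdivisions\<close>

text \<open>
  A finite rooted ordered binary tree is a \<^typ>\<open>unit tree\<close>: the library type of binary trees
  whose internal nodes carry no information.  Its \<^const>\<open>size\<close> is the number of internal nodes.

  The list \<open>leaf_intervals a b t\<close> contains, from left to right, the end points \<open>(c, d)\<close> of the
  half-open intervals \<open>[c, d)\<close> of the leaves of \<open>t\<close>, when the root of \<open>t\<close> corresponds to \<open>[a, b)\<close>.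
\<close>

fun leaf_intervals :: "real \<Rightarrow> real \<Rightarrow> unit tree \<Rightarrow> (real \<times> real) list" where
  "leaf_intervals a b Leaf = [(a, b)]"
| "leaf_intervals a b (Node l u r) =
     leaf_intervals a ((a + b) / 2) l @ leaf_intervals ((a + b) / 2) b r"

definition leaf_left :: "unit tree \<Rightarrow> nat \<Rightarrow> real" where
  "leaf_left t i = fst (leaf_intervals 0 1 t ! i)"

definition leaf_right :: "unit tree \<Rightarrow> nat \<Rightarrow> real" where
  "leaf_right t i = snd (leaf_intervals 0 1 t ! i)"

section \<open>Fully marked tree pair diagrams\<close>

text \<open>
  The leaves of a tree of size \<open>n\<close> are numbered \<open>0, \<dots>, n\<close>.  A bijection from the leaves of the
  source to those of the target is a permutation of \<open>{..n}\<close>; \<^const>\<open>permutes\<close> makes it the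
  identity outside \<open>{..n}\<close>, so that every bijection is represented exactly once.
\<close>

type_synonym diagram = "unit tree \<times> unit tree \<times> (nat \<Rightarrow> nat)"

definition diagrams :: "nat \<Rightarrow> diagram set" where
  "diagrams n = {(S, R, \<pi>). size S = n \<and> size R = n \<and> \<pi> permutes {..n}}"

text \<open>
  The circle is represented by its fundamental domain \<open>[0, 1)\<close>; the value of \<open>diagram_map\<close> at
  points outside \<open>[0, 1)\<close> is irrelevant.
\<close>

definition diagram_map :: "diagram \<Rightarrow> real \<Rightarrow> real" where
  "diagram_map = (\<lambda>(S, R, \<pi>) x.
     let i = (THE i. i \<le> size S \<and> x \<in> {leaf_left S i..<leaf_right S i}) in
       leaf_left R (\<pi> i) +
       (leaf_right R (\<pi> i) - leaf_left R (\<pi> i)) / (leaf_right S i - leaf_left S i)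
         * (x - leaf_left S i))"

section \<open>Thompson's group V\<close>

definition dyadic_rationals :: "real set" where
  "dyadic_rationals = {of_int k / 2 ^ m | (k :: int) (m :: nat). True}"

text \<open>
  The finite set \<open>B\<close> contains the breakpoints and discontinuities, and also the points at which
  a continuous piece crosses the end points of \<open>[0, 1)\<close> in the domain or in the range; the latter
  points are dyadic as well.
\<close>

definition thompson_V :: "(real \<Rightarrow> real) set" where
  "thompson_V = {g. bij_betw g {0..<1} {0..<1} \<and>
     g ` (dyadic_rationals \<inter> {0..<1}) \<subseteq> dyadic_rationals \<and>
     (\<forall>x\<in>{0..<1}. continuous (at_right x) g) \<and>
     (\<exists>B. finite B \<and> B \<subseteq> dyadic_rationals \<and>
        (\<forall>x\<in>{0..<1} - B. \<exists>e>0. \<exists>k::int. \<forall>y\<in>ball x e.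
           g y = g x + 2 powi k * (y - x)))}"

section \<open>North-south dynamics on the circle\<close>

text \<open>
  The topology of \<open>S\<^sup>1 = \<real>/\<int>\<close>, transported to \<open>[0, 1)\<close> along the bijection
  \<open>t \<mapsto> exp (2 \<pi> i t)\<close> onto the unit circle; so \<open>0\<close> and \<open>1\<close> are glued.
\<close>

definition circle_topology :: "real topology" where
  "circle_topology = pullback_topology {0..<1} (\<lambda>t. cis (2 * pi * t)) euclidean"

definition attracting :: "(real \<Rightarrow> real) \<Rightarrow> real \<Rightarrow> bool" where
  "attracting h p \<longleftrightarrow>
     (\<exists>U. openin circle_topology U \<and> p \<in> U \<and>
        (\<forall>x\<in>U. limitin circle_topology (\<lambda>m. (h ^^ m) x) p sequentially))"

definition north_south :: "(real \<Rightarrow> real) \<Rightarrow> bool" where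
  "north_south g \<longleftrightarrow>
     bij_betw g {0..<1} {0..<1} \<and>
     (\<exists>p q. p \<noteq> q \<and> {x \<in> {0..<1}. g x = x} = {p, q} \<and>
        attracting g p \<and> attracting (inv_into {0..<1} g) q)"

definition north_south_fraction :: "nat \<Rightarrow> real" where
  "north_south_fraction n =
     real (card {D \<in> diagrams n. north_south (diagram_map D)}) / real (card (diagrams n))"

section \<open>Basic facts\<close>

lemma length_leaf_intervals [simp]: "length (leaf_intervals a b t) = Suc (size t)"
  by (induction t arbitrary: a b) auto

lemma leaf_intervals_dyadic:
  assumes "(c, d) \<in> set (leaf_intervals a b t)"
  shows "\<exists>k m. c = a + (b - a) * real k / 2 ^ m \<and> d - c = (b - a) / 2 ^ m \<and> Suc k \<le> 2 ^ m"
  using assms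
proof (induction t arbitrary: a b)
  case Leaf
  then show ?case by (intro exI[of _ 0]) auto
next
  case (Node l u r)
  let ?M = "(a + b) / 2"
  from Node.prems consider "(c, d) \<in> set (leaf_intervals a ?M l)"
    | "(c, d) \<in> set (leaf_intervals ?M b r)" by auto
  then show ?case
  proof cases
    case 1
    from Node.IH(1)[OF 1] obtain k m where
      *: "c = a + (?M - a) * real k / 2 ^ m" "d - c = (?M - a) / 2 ^ m" "Suc k \<le> 2 ^ m" by blast
    have "c = a + (b - a) * real k / 2 ^ Suc m" "d - c = (b - a) / 2 ^ Suc m"
      unfolding *(2) unfolding *(1) by (simp_all add: field_simps)
    moreover have "Suc k \<le> 2 ^ Suc m" using *(3) by simp
    ultimately show ?thesis by blast
  next
    case 2
    from Node.IH(2)[OF 2] obtain k m where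
      *: "c = ?M + (b - ?M) * real k / 2 ^ m" "d - c = (b - ?M) / 2 ^ m" "Suc k \<le> 2 ^ m" by blast
    have "c = a + (b - a) * real (2 ^ m + k) / 2 ^ Suc m" "d - c = (b - a) / 2 ^ Suc m"
      unfolding *(2) unfolding *(1) by (simp_all add: field_simps)
    moreover have "Suc (2 ^ m + k) \<le> 2 ^ Suc m" using *(3) by simp
    ultimately show ?thesis by blast
  qed
qed

lemma leaf_intervals_bounds:
  assumes "(c, d) \<in> set (leaf_intervals a b t)" "a < b"
  shows "a \<le> c \<and> c < d \<and> d \<le> b"
  using assms
proof (induction t arbitrary: a b)
  case Leaf
  then show ?case by auto
next
  case (Node l u r)
  from Node.prems show ?case
    using Node.IH(1)[of a "(a + b) / 2"] Node.IH(2)[of "(a + b) / 2" b] by fastforce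
qed

lemma leaf_intervals_ex1:
  assumes "a \<le> x" "x < b"
  shows "\<exists>!i. i \<le> size t \<and> fst (leaf_intervals a b t ! i) \<le> x \<and> x < snd (leaf_intervals a b t ! i)"
  using assms
proof (induction t arbitrary: a b)
  case Leaf
  then show ?case by auto
next
  case (Node l u r)
  let ?M = "(a + b) / 2"
  let ?L = "leaf_intervals a ?M l" and ?R = "leaf_intervals ?M b r"
  have M: "a < ?M" "?M < b" using Node.prems by auto
  have bL: "snd (?L ! i) \<le> ?M" if "i \<le> size l" for i
    using leaf_intervals_bounds[of "fst (?L ! i)" "snd (?L ! i)" a ?M l] M that by simp
  have bR: "fst (?R ! i) \<ge> ?M" if "i \<le> size r" for i
    using leaf_intervals_bounds[of "fst (?R ! i)" "snd (?R ! i)" ?M b r] M that by simp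
  show ?case
  proof (cases "x < ?M")
    case True
    from Node.IH(1)[OF Node.prems(1) True] obtain i where
      i: "i \<le> size l" "fst (?L ! i) \<le> x" "x < snd (?L ! i)"
      and u: "\<And>j. j \<le> size l \<Longrightarrow> fst (?L ! j) \<le> x \<Longrightarrow> x < snd (?L ! j) \<Longrightarrow> j = i" by blast
    show ?thesis
    proof (rule ex1I[of _ i])
      fix j
      assume j: "j \<le> size \<langle>l, u, r\<rangle> \<and> fst (leaf_intervals a b \<langle>l, u, r\<rangle> ! j) \<le> x \<and>
        x < snd (leaf_intervals a b \<langle>l, u, r\<rangle> ! j)"
      show "j = i"
      proof (cases "j \<le> size l")
        case True
        then show ?thesis using j u by (auto simp: nth_append)
      next
        case False
        then have "?M \<le> fst (?R ! (j - Suc (size l)))" using j by (intro bR) auto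
        then show ?thesis using j False \<open>x < ?M\<close> by (auto simp: nth_append)
      qed
    qed (use i in \<open>auto simp: nth_append\<close>)
  next
    case False
    then have "?M \<le> x" by simp
    from Node.IH(2)[OF this Node.prems(2)] obtain i where
      i: "i \<le> size r" "fst (?R ! i) \<le> x" "x < snd (?R ! i)"
      and u: "\<And>j. j \<le> size r \<Longrightarrow> fst (?R ! j) \<le> x \<Longrightarrow> x < snd (?R ! j) \<Longrightarrow> j = i" by blast
    show ?thesis
    proof (rule ex1I[of _ "Suc (size l) + i"])
      fix j
      assume j: "j \<le> size \<langle>l, u, r\<rangle> \<and> fst (leaf_intervals a b \<langle>l, u, r\<rangle> ! j) \<le> x \<and>
        x < snd (leaf_intervals a b \<langle>l, u, r\<rangle> ! j)"
      show "j = Suc (size l) + i"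
      proof (cases "j \<le> size l")
        case True
        then show ?thesis using j bL[of j] \<open>?M \<le> x\<close> by (auto simp: nth_append)
      next
        case False
        then have "j - Suc (size l) = i" using j by (intro u) (auto simp: nth_append)
        then show ?thesis using False by auto
      qed
    qed (use i in \<open>auto simp: nth_append\<close>)
  qed
qed

lemma leaf_ex1:
  assumes "x \<in> {0..<1}"
  shows "\<exists>!i. i \<le> size t \<and> x \<in> {leaf_left t i..<leaf_right t i}"
  using leaf_intervals_ex1[of 0 x 1 t] assms by (simp add: leaf_left_def leaf_right_def)

lemma leaf_in_set:
  assumes "i \<le> size t"
  shows "(leaf_left t i, leaf_right t i) \<in> set (leaf_intervals 0 1 t)"
  using assms by (simp add: leaf_left_def leaf_right_def)

lemma leaf_bounds:
  assumes "i \<le> size t"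
  shows "0 \<le> leaf_left t i" "leaf_left t i < leaf_right t i" "leaf_right t i \<le> 1"
  using leaf_intervals_bounds[OF leaf_in_set[OF assms]] by auto

lemma unit_interval_eq_leaves:
  "{0..<1} = (\<Union>i\<le>size t. {leaf_left t i..<leaf_right t i})"
proof (intro equalityI subsetI)
  fix x :: real assume "x \<in> {0..<1}"
  then show "x \<in> (\<Union>i\<le>size t. {leaf_left t i..<leaf_right t i})" using leaf_ex1 by blast
next
  fix x assume "x \<in> (\<Union>i\<le>size t. {leaf_left t i..<leaf_right t i})"
  then obtain i where "i \<le> size t" "x \<in> {leaf_left t i..<leaf_right t i}" by blast
  then show "x \<in> {0..<1}" using leaf_bounds[of i t] by auto
qed

lemma leaf_width:
  assumes "i \<le> size t"
  shows "\<exists>m::nat. leaf_right t i - leaf_left t i = 1 / 2 ^ m"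
  using leaf_intervals_dyadic[OF leaf_in_set[OF assms]] by auto

lemma leaf_left_dyadic:
  assumes "i \<le> size t"
  shows "leaf_left t i \<in> dyadic_rationals"
proof -
  from leaf_intervals_dyadic[OF leaf_in_set[OF assms]] obtain k m where
    "leaf_left t i = real k / 2 ^ m" by auto
  then have "leaf_left t i = of_int (int k) / 2 ^ m" by simp
  then show ?thesis unfolding dyadic_rationals_def by blast
qed

lemma diagram_map_eq:
  assumes "i \<le> size S" "x \<in> {leaf_left S i..<leaf_right S i}"
  shows "diagram_map (S, R, \<pi>) x = leaf_left R (\<pi> i) +
       (leaf_right R (\<pi> i) - leaf_left R (\<pi> i)) / (leaf_right S i - leaf_left S i)
         * (x - leaf_left S i)"
proof -
  have "x \<in> {0..<1}" using assms leaf_bounds[OF assms(1)] by auto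
  from leaf_ex1[OF this, of S] assms have
    "(THE i. i \<le> size S \<and> x \<in> {leaf_left S i..<leaf_right S i}) = i"
    by (intro the1_equality) auto
  then show ?thesis by (simp add: diagram_map_def)
qed

lemma affine_bij_betw:
  fixes a b c d :: real
  assumes "a < b" "c < d"
  shows "bij_betw (\<lambda>x. c + (d - c) / (b - a) * (x - a)) {a..<b} {c..<d}"
proof (rule bij_betw_byWitness[where f' = "\<lambda>y. a + (b - a) / (d - c) * (y - c)"])
  have aux: "c + (d - c) / (b - a) * (x - a) \<in> {c..<d}" if "a < b" "c < d" "x \<in> {a..<b}"
    for a b c d x :: real
  proof -
    define r where "r = (x - a) / (b - a)"
    have r: "0 \<le> r" "r < 1" using that by (simp_all add: r_def)
    have "(d - c) * r < (d - c) * 1" using r that by (intro mult_strict_left_mono) auto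
    moreover have "0 \<le> (d - c) * r" using r that by simp
    moreover have "(d - c) / (b - a) * (x - a) = (d - c) * r" by (simp add: r_def)
    ultimately show ?thesis by simp
  qed
  show "(\<lambda>x. c + (d - c) / (b - a) * (x - a)) ` {a..<b} \<subseteq> {c..<d}"
    "(\<lambda>y. a + (b - a) / (d - c) * (y - c)) ` {c..<d} \<subseteq> {a..<b}"
    using aux assms by blast+
qed (use assms in auto)

lemma diagram_map_bij_betw_leaf:
  assumes "(S, R, \<pi>) \<in> diagrams n" "i \<le> n"
  shows "bij_betw (diagram_map (S, R, \<pi>)) {leaf_left S i..<leaf_right S i}
           {leaf_left R (\<pi> i)..<leaf_right R (\<pi> i)}"
proof -
  have sz: "size S = n" "size R = n" "\<pi> permutes {..n}" using assms by (auto simp: diagrams_def)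
  then have "\<pi> i \<le> size R" using assms(2) permutes_in_image[of \<pi> "{..n}" i] by simp
  then have "bij_betw (\<lambda>x. leaf_left R (\<pi> i) +
       (leaf_right R (\<pi> i) - leaf_left R (\<pi> i)) / (leaf_right S i - leaf_left S i)
         * (x - leaf_left S i)) {leaf_left S i..<leaf_right S i}
           {leaf_left R (\<pi> i)..<leaf_right R (\<pi> i)}"
    using sz assms(2) leaf_bounds[of i S] leaf_bounds[of "\<pi> i" R] by (intro affine_bij_betw) auto
  then show ?thesis
    by (rule iffD1[OF bij_betw_cong, rotated]) (use diagram_map_eq sz assms(2) in auto)
qed

lemma diagram_map_bij_betw:
  assumes "D \<in> diagrams n"
  shows "bij_betw (diagram_map D) {0..<1} {0..<1}"
proof -
  obtain S R \<pi> where D: "D = (S, R, \<pi>)" by (cases D)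
  have sz: "size S = n" "size R = n" and p: "\<pi> permutes {..n}"
    using assms by (auto simp: diagrams_def D)
  let ?g = "diagram_map D"
  let ?A = "\<lambda>i. {leaf_left S i..<leaf_right S i}" and ?B = "\<lambda>i. {leaf_left R i..<leaf_right R i}"
  have b: "bij_betw ?g (?A i) (?B (\<pi> i))" if "i \<le> n" for i
    using diagram_map_bij_betw_leaf[of S R \<pi> n i] assms that D by simp
  have img: "?g ` ?A i = ?B (\<pi> i)" if "i \<le> n" for i using b[OF that] by (simp add: bij_betw_def)
  have pin: "\<pi> i \<le> n" if "i \<le> n" for i using permutes_in_image[OF p, of i] that by simp
  have A: "{0..<1} = (\<Union>i\<le>n. ?A i)"
    using unit_interval_eq_leaves[of S] sz by simp
  have "{0..<1} = (\<Union>i\<le>n. ?B i)"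
    using unit_interval_eq_leaves[of R] sz by simp
  also have "\<dots> = (\<Union>i\<in>\<pi> ` {..n}. ?B i)" using permutes_image[OF p] by simp
  finally have B: "{0..<1} = (\<Union>i\<le>n. ?B (\<pi> i))" by simp
  have "inj_on ?g {0..<1}"
  proof (rule inj_onI)
    fix x y assume xy: "x \<in> {0..<1}" "y \<in> {0..<1}" "?g x = ?g y"
    from leaf_ex1[OF xy(1), of S] obtain i where i: "i \<le> n" "x \<in> ?A i" using sz by blast
    from leaf_ex1[OF xy(2), of S] obtain j where j: "j \<le> n" "y \<in> ?A j" using sz by blast
    have gi: "?g x \<in> ?B (\<pi> i)" using img[OF i(1)] i(2) by blast
    have gj: "?g x \<in> ?B (\<pi> j)" using img[OF j(1)] j(2) xy(3) by (metis imageI)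
    have "?g x \<in> {0..<1}" using gi leaf_bounds[of "\<pi> i" R] pin[OF i(1)] sz by simp
    from leaf_ex1[OF this, of R] obtain l where
      l: "\<And>k. k \<le> size R \<Longrightarrow> ?g x \<in> ?B k \<Longrightarrow> k = l" by auto
    have "\<pi> i = l" "\<pi> j = l" using l gi gj pin i(1) j(1) sz by simp_all
    then have "\<pi> i = \<pi> j" by simp
    then have "i = j" using permutes_inj[OF p] by (simp add: inj_eq)
    then show "x = y"
      using inj_onD[OF bij_betw_imp_inj_on[OF b[OF i(1)]] xy(3) i(2)] j(2) by simp
  qed
  moreover have "?g ` (\<Union>i\<le>n. ?A i) = (\<Union>i\<le>n. ?g ` ?A i)" by (rule image_UN)
  then have "?g ` {0..<1} = {0..<1}" unfolding A[symmetric] using img B by simp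
  ultimately show ?thesis by (simp add: bij_betw_def)
qed

lemma dyadic_rationals_add:
  assumes "x \<in> dyadic_rationals" "y \<in> dyadic_rationals"
  shows "x + y \<in> dyadic_rationals"
proof -
  from assms obtain k l :: int and m n :: nat where "x = of_int k / 2 ^ m" "y = of_int l / 2 ^ n"
    by (auto simp: dyadic_rationals_def)
  then have "x + y = of_int (k * 2 ^ n + l * 2 ^ m) / 2 ^ (m + n)"
    by (simp add: add_divide_distrib power_add)
  then show ?thesis unfolding dyadic_rationals_def by blast
qed

lemma dyadic_rationals_diff:
  assumes "x \<in> dyadic_rationals" "y \<in> dyadic_rationals"
  shows "x - y \<in> dyadic_rationals"
proof -
  from assms obtain k l :: int and m n :: nat where "x = of_int k / 2 ^ m" "y = of_int l / 2 ^ n"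
    by (auto simp: dyadic_rationals_def)
  then have "x - y = of_int (k * 2 ^ n - l * 2 ^ m) / 2 ^ (m + n)"
    by (simp add: diff_divide_distrib power_add)
  then show ?thesis unfolding dyadic_rationals_def by blast
qed

lemma dyadic_rationals_scale:
  assumes "x \<in> dyadic_rationals"
  shows "2 ^ n' / 2 ^ n * x \<in> dyadic_rationals"
proof -
  from assms obtain k :: int and m :: nat where "x = of_int k / 2 ^ m"
    by (auto simp: dyadic_rationals_def)
  then have "2 ^ n' / 2 ^ n * x = of_int (k * 2 ^ n') / 2 ^ (m + n)"
    by (simp add: power_add mult.commute)
  then show ?thesis unfolding dyadic_rationals_def by blast
qed

lemma diagram_map_in_thompson_V:
  assumes "D \<in> diagrams n"
  shows "diagram_map D \<in> thompson_V"
proof -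
  obtain S R \<pi> where D: "D = (S, R, \<pi>)" by (cases D)
  have sz: "size S = n" "size R = n" and p: "\<pi> permutes {..n}"
    using assms by (auto simp: diagrams_def D)
  let ?g = "diagram_map D"
  let ?A = "\<lambda>i. {leaf_left S i..<leaf_right S i}"
  have pin: "\<pi> i \<le> n" if "i \<le> n" for i using permutes_in_image[OF p, of i] that by simp
  have *: "\<exists>m m'. \<forall>x\<in>?A i. ?g x = leaf_left R (\<pi> i) + 2 ^ m / 2 ^ m' * (x - leaf_left S i)"
    if i: "i \<le> n" for i
  proof -
    obtain m where m: "leaf_right S i - leaf_left S i = 1 / 2 ^ m"
      using leaf_width[of i S] i sz by auto
    obtain m' where m': "leaf_right R (\<pi> i) - leaf_left R (\<pi> i) = 1 / 2 ^ m'"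
      using leaf_width[of "\<pi> i" R] pin[OF i] sz by auto
    have "?g x = leaf_left R (\<pi> i) + 2 ^ m / 2 ^ m' * (x - leaf_left S i)" if "x \<in> ?A i" for x
      unfolding D using i sz that by (subst diagram_map_eq[of i]) (auto simp: m m')
    then show ?thesis by blast
  qed
  have ex: "\<exists>i m m'. i \<le> n \<and> x \<in> ?A i \<and>
      (\<forall>x\<in>?A i. ?g x = leaf_left R (\<pi> i) + 2 ^ m / 2 ^ m' * (x - leaf_left S i))"
    if x: "x \<in> {0..<1}" for x
  proof -
    obtain i where "i \<le> n" "x \<in> ?A i" using leaf_ex1[OF x, of S] sz by blast
    with *[of i] show ?thesis by auto
  qed
  have "?g x \<in> dyadic_rationals" if x: "x \<in> dyadic_rationals \<inter> {0..<1}" for x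
  proof -
    obtain i m m' where i: "i \<le> n" "x \<in> ?A i" and
      eq: "\<forall>x\<in>?A i. ?g x = leaf_left R (\<pi> i) + 2 ^ m / 2 ^ m' * (x - leaf_left S i)"
      using ex[OF IntD2[OF x]] by (elim exE conjE) (rule that)
    have l: "leaf_left R (\<pi> i) \<in> dyadic_rationals" "leaf_left S i \<in> dyadic_rationals"
      using leaf_left_dyadic[of "\<pi> i" R] leaf_left_dyadic[of i S] pin[OF i(1)] i(1) sz by simp_all
    have "2 ^ m / 2 ^ m' * (x - leaf_left S i) \<in> dyadic_rationals"
      using x l by (intro dyadic_rationals_scale dyadic_rationals_diff) auto
    then show ?thesis using bspec[OF eq i(2)] l(1) by (simp only: dyadic_rationals_add)
  qed
  then have dy: "?g ` (dyadic_rationals \<inter> {0..<1}) \<subseteq> dyadic_rationals" by blast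
  have cont: "continuous (at_right x) ?g" if x: "x \<in> {0..<1}" for x
  proof -
    obtain i m m' where i: "i \<le> n" "x \<in> ?A i" and
      eq: "\<forall>x\<in>?A i. ?g x = leaf_left R (\<pi> i) + 2 ^ m / 2 ^ m' * (x - leaf_left S i)"
      using ex[OF x] by (elim exE conjE) (rule that)
    have "((\<lambda>x. leaf_left R (\<pi> i) + 2 ^ m / 2 ^ m' * (x - leaf_left S i)) \<longlongrightarrow>
        leaf_left R (\<pi> i) + 2 ^ m / 2 ^ m' * (x - leaf_left S i)) (at_right x)"
      by (intro tendsto_intros)
    moreover have "eventually (\<lambda>y. y \<in> {x<..<leaf_right S i}) (at_right x)"
      using i by (intro eventually_at_right_real) auto
    then have "eventually (\<lambda>y. leaf_left R (\<pi> i) + 2 ^ m / 2 ^ m' * (y - leaf_left S i) = ?g y)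
        (at_right x)"
    proof eventually_elim
      case (elim y)
      then have "y \<in> ?A i" using i(2) by auto
      then show ?case using eq by simp
    qed
    ultimately have "(?g \<longlongrightarrow> leaf_left R (\<pi> i) + 2 ^ m / 2 ^ m' * (x - leaf_left S i)) (at_right x)"
      by (rule Lim_transform_eventually)
    then show ?thesis using bspec[OF eq i(2)] by (simp only: continuous_within)
  qed
  have loc: "\<exists>e>0. \<exists>k::int. \<forall>y\<in>ball x e. ?g y = ?g x + 2 powi k * (y - x)"
    if x: "x \<in> {0..<1} - leaf_left S ` {..n}" for x
  proof -
    obtain i m m' where i: "i \<le> n" "x \<in> ?A i" and
      eq: "\<forall>x\<in>?A i. ?g x = leaf_left R (\<pi> i) + 2 ^ m / 2 ^ m' * (x - leaf_left S i)"
      using ex[OF DiffD1[OF x]] by (elim exE conjE) (rule that)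
    have "x \<noteq> leaf_left S i" using x i by auto
    then have "x \<in> {leaf_left S i<..<leaf_right S i}" using i by auto
    then obtain e where e: "e > 0" "ball x e \<subseteq> {leaf_left S i<..<leaf_right S i}"
      using open_contains_ball open_greaterThanLessThan by metis
    have "?g y = ?g x + 2 powi (int m - int m') * (y - x)" if "y \<in> ball x e" for y
    proof -
      have "y \<in> ?A i" using e that by auto
      have "?g y = ?g x + 2 ^ m / 2 ^ m' * (y - x)"
        using bspec[OF eq i(2)] bspec[OF eq \<open>y \<in> ?A i\<close>] by (simp add: right_diff_distrib)
      then show ?thesis by (simp add: power_int_diff)
    qed
    then show ?thesis using e by blast
  qed
  have "leaf_left S ` {..n} \<subseteq> dyadic_rationals" using leaf_left_dyadic sz by auto
  then have B: "\<exists>B. finite B \<and> B \<subseteq> dyadic_rationals \<and>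
      (\<forall>x\<in>{0..<1} - B. \<exists>e>0. \<exists>k::int. \<forall>y\<in>ball x e. ?g y = ?g x + 2 powi k * (y - x))"
    using loc by (intro exI[of _ "leaf_left S ` {..n}"]) auto
  show ?thesis unfolding thompson_V_def
    using diagram_map_bij_betw[OF assms] dy cont B by blast
qed

lemma finite_trees: "finite {t :: unit tree. size t = n}"
proof (induction n rule: less_induct)
  case (less n)
  have "{t :: unit tree. size t = n} \<subseteq>
      insert Leaf ((\<lambda>(l, r). Node l () r) `
        ((\<Union>i<n. {t. size t = i}) \<times> (\<Union>i<n. {t. size t = i})))"
  proof
    fix t :: "unit tree" assume "t \<in> {t. size t = n}"
    then show "t \<in> insert Leaf ((\<lambda>(l, r). Node l () r) `
        ((\<Union>i<n. {t. size t = i}) \<times> (\<Union>i<n. {t. size t = i})))"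
      by (cases t) (force simp: image_iff)+
  qed
  moreover have "finite (insert Leaf ((\<lambda>(l, r). Node l () r) `
      ((\<Union>i<n. {t :: unit tree. size t = i}) \<times> (\<Union>i<n. {t :: unit tree. size t = i}))))"
    using less by auto
  ultimately show ?case by (rule finite_subset)
qed

lemma diagrams_eq:
  "diagrams n = {t. size t = n} \<times> {t. size t = n} \<times> {\<pi>. \<pi> permutes {..n}}"
  by (auto simp: diagrams_def)

lemma finite_diagrams: "finite (diagrams n)"
  by (simp add: diagrams_eq finite_trees finite_permutations)

lemma card_diagrams:
  "card (diagrams n) = fact (n + 1) * card {t :: unit tree. size t = n} ^ 2"
  by (simp add: diagrams_eq card_cartesian_product card_permutations[OF refl] power2_eq_square)

lemma topspace_circle: "topspace circle_topology = {0..<1}"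
  by (simp add: circle_topology_def topspace_pullback_topology)

lemma limitin_circle:
  "limitin circle_topology f p F \<longleftrightarrow>
     p \<in> {0..<1} \<and> eventually (\<lambda>m. f m \<in> {0..<1}) F \<and>
     ((\<lambda>m. cis (2 * pi * f m)) \<longlongrightarrow> cis (2 * pi * p)) F" (is "?l \<longleftrightarrow> ?r")
proof
  assume l: ?l
  then have p: "p \<in> {0..<1}" using limitin_topspace[OF l] by (simp add: topspace_circle)
  have nb: "eventually (\<lambda>m. f m \<in> W) F" if "openin circle_topology W" "p \<in> W" for W
    using l that by (simp add: limitin_def)
  have "openin circle_topology {0..<1}" using openin_topspace[of circle_topology]
    by (simp only: topspace_circle)
  then have "eventually (\<lambda>m. f m \<in> {0..<1}) F" using p by (rule nb)
  moreover have "eventually (\<lambda>m. cis (2 * pi * f m) \<in> U) F" if "open U" "cis (2 * pi * p) \<in> U" for U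
  proof -
    have "openin circle_topology ((\<lambda>t. cis (2 * pi * t)) -` U \<inter> {0..<1})"
      unfolding circle_topology_def openin_pullback_topology using that(1) by auto
    then have "eventually (\<lambda>m. f m \<in> (\<lambda>t. cis (2 * pi * t)) -` U \<inter> {0..<1}) F"
      using p that(2) by (intro nb) auto
    then show ?thesis by (rule eventually_mono) auto
  qed
  ultimately show ?r using p by (intro conjI topological_tendstoI)
next
  assume r: ?r
  have "eventually (\<lambda>m. f m \<in> W) F" if W: "openin circle_topology W" "p \<in> W" for W
  proof -
    obtain U where U: "open U" "W = (\<lambda>t. cis (2 * pi * t)) -` U \<inter> {0..<1}"
      using W unfolding circle_topology_def openin_pullback_topology by auto
    have "eventually (\<lambda>m. cis (2 * pi * f m) \<in> U) F"
      using r U W(2) by (intro topological_tendstoD) auto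
    moreover have "eventually (\<lambda>m. f m \<in> {0..<1}) F" using r by blast
    ultimately show ?thesis unfolding U(2) by eventually_elim auto
  qed
  then show ?l using r by (simp add: limitin_def topspace_circle)
qed

end

theory Submission
  imports Defs
begin

text \<open>
  The limit is \<open>1\<close>.  In a large uniform tree one of the two subtrees of the root has bounded size
  with probability close to \<open>1\<close>, and it is the left or the right one with equal probability.
  Descending simultaneously in \<open>S\<close> and \<open>R\<close> towards the large subtree of \<open>R\<close>, one leaves \<open>S\<close>
  after boundedly many steps, so up to an event of small probability some leaf \<open>u\<close> of \<open>S\<close> has all
  but boundedly many leaves of \<open>R\<close> below it, and symmetrically some leaf \<open>v\<close> of \<open>R\<close> has all but
  boundedly many leaves of \<open>S\<close> below it.  For such a pair of trees a random bijection \<open>\<pi>\<close> has,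
  with probability \<open>1 - O(1/n)\<close>, the following properties: \<open>\<pi> u\<close> lies strictly inside \<open>u\<close>, which
  gives an attracting fixed point; the preimage of \<open>v\<close> lies strictly inside \<open>v\<close>, which gives a
  repelling one; and no other leaf meets its image.
\<close>

section \<open>Catalan numbers\<close>

abbreviation trees :: "nat \<Rightarrow> unit tree set" where
  "trees n \<equiv> {t. size t = n}"

lemma trees_0 [simp]: "trees 0 = {Leaf}"
  by auto

text \<open>A nonempty tree is an ordered pair of subtrees; this turns counts over trees into
  convolutions of Catalan numbers.\<close>

lemma sum_trees_Suc:
  fixes f :: "unit tree \<Rightarrow> 'a :: comm_monoid_add"
  shows "(\<Sum>t\<in>trees (Suc n). f t) =
    (\<Sum>k\<le>n. \<Sum>l\<in>trees k. \<Sum>r\<in>trees (n - k). f \<langle>l, (), r\<rangle>)"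
proof -
  have *: "\<langle>left t, (), right t\<rangle> = t" "size (left t) \<le> n" "size (right t) = n - size (left t)"
    if "size t = Suc n" for t :: "unit tree"
    using that by (cases t; simp)+
  have "(\<Sum>k\<le>n. \<Sum>l\<in>trees k. \<Sum>r\<in>trees (n - k). f \<langle>l, (), r\<rangle>) =
      (\<Sum>(k, l, r)\<in>(SIGMA k:{..n}. trees k \<times> trees (n - k)). f \<langle>l, (), r\<rangle>)"
    by (simp add: sum.cartesian_product sum.Sigma finite_trees)
  also have "\<dots> = (\<Sum>t\<in>trees (Suc n). f t)"
    by (rule sum.reindex_bij_witness[where
          i = "\<lambda>t. (size (left t), left t, right t)" and j = "\<lambda>(k, l, r). \<langle>l, (), r\<rangle>"])
       (auto simp: *)
  finally show ?thesis by simp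
qed

definition catalan :: "nat \<Rightarrow> real" where
  "catalan n = real (card (trees n))"

lemma catalan_0 [simp]: "catalan 0 = 1"
  by (simp add: catalan_def)

lemma catalan_Suc: "catalan (Suc n) = (\<Sum>k\<le>n. catalan k * catalan (n - k))"
proof -
  have "catalan (Suc n) = (\<Sum>t\<in>trees (Suc n). 1)"
    by (simp add: catalan_def)
  also have "\<dots> = (\<Sum>k\<le>n. \<Sum>l\<in>trees k. \<Sum>r\<in>trees (n - k). 1)"
    by (rule sum_trees_Suc)
  finally show ?thesis by (simp add: catalan_def)
qed

text \<open>The convolution identity for \<open>\<surd>(1 - x) \<cdot> \<surd>(1 - x) = 1 - x\<close> identifies the solution of
  the quadratic recursion.\<close>

lemma catalan_gbinomial: "catalan n = 2 * (-1) ^ n * 4 ^ n * ((1/2 :: real) gchoose Suc n)"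
proof (induction n rule: less_induct)
  case (less n)
  show ?case
  proof (cases n)
    case 0
    then show ?thesis by simp
  next
    case (Suc m)
    define h where "h k = ((1/2 :: real) gchoose k)" for k
    have "(\<Sum>k=0..Suc n. h k * h (Suc n - k)) = (1/2 + 1/2 :: real) gchoose (Suc n)"
      unfolding h_def by (rule gbinomial_Vandermonde)
    also have "\<dots> = of_nat (1 choose Suc n)"
      by (simp only: binomial_gbinomial) simp
    \<comment> \<open>\<open>Suc n\<close> is at least 2 in this case, so 1 choose
      \<open>Suc n\<close> vanishes.\<close>
    finally have "(\<Sum>k\<le>Suc n. h k * h (Suc n - k)) = 0"
      using Suc by (simp add: atMost_atLeast0)
    \<comment> \<open>The two extreme summands contain \<open>h 0 = 1\<close>; the others are the
      products to which the induction hypothesis applies.\<close>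
    moreover have "(\<Sum>k\<le>Suc n. h k * h (Suc n - k)) =
        2 * h (Suc n) + (\<Sum>k\<le>m. h (Suc k) * h (Suc (m - k)))"
    proof -
      have "(\<Sum>k\<le>Suc n. h k * h (Suc n - k)) =
          h 0 * h (Suc n) + ((\<Sum>k\<le>m. h (Suc k) * h (n - k)) + h (Suc n) * h 0)"
        by (subst sum.atMost_Suc_shift, simp only: Suc, subst sum.atMost_Suc) simp
      also have "(\<Sum>k\<le>m. h (Suc k) * h (n - k)) = (\<Sum>k\<le>m. h (Suc k) * h (Suc (m - k)))"
        by (intro sum.cong) (auto simp: Suc Suc_diff_le)
      finally show ?thesis by (simp add: h_def)
    qed
    ultimately have *: "(\<Sum>k\<le>m. h (Suc k) * h (Suc (m - k))) = - 2 * h (Suc n)" by simp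
    have "catalan n = (\<Sum>k\<le>m. catalan k * catalan (m - k))"
      by (simp add: Suc catalan_Suc)
    also have "\<dots> = (\<Sum>k\<le>m. 4 * (-1) ^ m * 4 ^ m * (h (Suc k) * h (Suc (m - k))))"
    proof (rule sum.cong)
      fix k assume "k \<in> {..m}"
      then have "m = k + (m - k)" by simp
      then have "(-1 :: real) ^ m = (-1) ^ k * (-1) ^ (m - k)" "(4 :: real) ^ m = 4 ^ k * 4 ^ (m - k)"
        by (metis power_add)+
      then show "catalan k * catalan (m - k) = 4 * (-1) ^ m * 4 ^ m * (h (Suc k) * h (Suc (m - k)))"
        using less.IH[of k] less.IH[of "m - k"] \<open>k \<in> {..m}\<close> Suc by (simp add: h_def)
    qed simp
    also have "\<dots> = 4 * (-1) ^ m * 4 ^ m * (- 2 * h (Suc n))"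
      by (simp only: * sum_distrib_left[symmetric])
    finally show ?thesis by (simp add: h_def Suc)
  qed
qed

text \<open>Consecutive coefficients \<open>1/2 gchoose k\<close> have a rational ratio, so the
  closed form yields a first-order recursion. The factor \<open>- 8 * (-1) ^ n * 4 ^ n\<close> in
  the proof is the prefactor of \<open>catalan (Suc n)\<close>.\<close>

lemma catalan_rec: "(real n + 2) * catalan (Suc n) = (4 * real n + 2) * catalan n"
proof -
  have "((1/2 :: real) gchoose Suc (Suc n)) * (real n + 2) =
      ((1/2 :: real) gchoose Suc n) * (1/2 - (real n + 1))"
    using gbinomial_mult_1[of "1/2 :: real" "Suc n"] by (simp add: algebra_simps)
  then have "(real n + 2) * ((1/2 :: real) gchoose Suc (Suc n)) =
      - (real n + 1/2) * ((1/2 :: real) gchoose Suc n)"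
    by (simp add: algebra_simps)
  then have "- 8 * (-1) ^ n * 4 ^ n * ((real n + 2) * ((1/2 :: real) gchoose Suc (Suc n))) =
      - 8 * (-1) ^ n * 4 ^ n * (- (real n + 1/2) * ((1/2 :: real) gchoose Suc n))"
    by (rule arg_cong)
  then show ?thesis unfolding catalan_gbinomial[of n] catalan_gbinomial[of "Suc n"]
    by (simp add: algebra_simps)
qed

lemma catalan_pos: "catalan n > 0"
proof (induction n)
  case (Suc n)
  then have "(real n + 2) * catalan (Suc n) > 0" by (simp only: catalan_rec) simp
  then show ?case by (simp add: zero_less_mult_iff)
qed simp

lemma catalan_Suc_le: "catalan (Suc n) \<le> 4 * catalan n"
proof -
  have "(real n + 2) * catalan (Suc n) \<le> (real n + 2) * (4 * catalan n)"
    using catalan_pos[of n] by (simp only: catalan_rec) (simp add: algebra_simps)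
  then show ?thesis by simp
qed

lemma catalan_add_le: "catalan (n + k) \<le> 4 ^ k * catalan n"
proof (induction k)
  case (Suc k)
  then show ?case using catalan_Suc_le[of "n + k"] by simp
qed simp

text \<open>The return probability \<open>(2n choose n) / 4\<^sup>n\<close> of the simple random walk.\<close>

definition central :: "nat \<Rightarrow> real" where
  "central n = (real n + 1) * catalan n / 4 ^ n"

text \<open>The sum telescopes: by \<open>catalan_rec\<close>, \<open>central\<close> drops by half
  of each summand. Since \<open>central\<close> tends to 0, the total mass is 2 and the tails are
  small, which is why small subtrees carry almost all the weight.\<close>

lemma sum_catalan: "(\<Sum>k<n. catalan k / 4 ^ k) = 2 * (1 - central n)"
proof (induction n)
  case (Suc n)
  have "central (Suc n) = (real n + 2) * catalan (Suc n) / 4 ^ Suc n"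
    by (simp add: central_def add_ac)
  also have "\<dots> = (4 * real n + 2) * catalan n / 4 ^ Suc n"
    by (simp only: catalan_rec)
  finally have "central (Suc n) = central n - catalan n / 4 ^ n / 2"
    by (simp add: central_def field_simps)
  then show ?case using Suc by simp
qed (simp add: central_def)

lemma central_nonneg: "central n \<ge> 0"
  using catalan_pos[of n] by (simp add: central_def)

lemma central_Suc: "(2 * real n + 2) * central (Suc n) = (2 * real n + 1) * central n"
proof -
  have "central (Suc n) = (real n + 2) * catalan (Suc n) / 4 ^ Suc n"
    by (simp add: central_def add_ac)
  also have "\<dots> = (4 * real n + 2) * catalan n / 4 ^ Suc n"
    by (simp only: catalan_rec)
  finally show ?thesis by (simp add: central_def field_simps)
qed

text \<open>By \<open>central_Suc\<close> the left side is multiplied by (2n+1)(2n+3)/(2n+2)^2 at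
  each step, which is below 1.\<close>

lemma central_square_le: "(2 * real n + 1) * (central n)\<^sup>2 \<le> 1"
proof (induction n)
  case (Suc n)
  have "(2 * real n + 2)\<^sup>2 * ((2 * real (Suc n) + 1) * (central (Suc n))\<^sup>2) =
      (2 * real n + 3) * ((2 * real n + 2) * central (Suc n))\<^sup>2"
    by (simp only: power_mult_distrib) (simp add: add_ac)
  also have "\<dots> = (2 * real n + 3) * (2 * real n + 1) * ((2 * real n + 1) * (central n)\<^sup>2)"
    by (simp add: central_Suc power_mult_distrib power2_eq_square)
  also have "\<dots> \<le> (2 * real n + 3) * (2 * real n + 1) * 1"
    using Suc by (intro mult_left_mono) auto
  also have "\<dots> \<le> (2 * real n + 2)\<^sup>2 * 1"
    by (simp add: power2_eq_square algebra_simps)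
  finally show ?case by (rule mult_left_le_imp_le) simp
qed (simp add: central_def)

lemma central_tendsto_0: "central \<longlonglongrightarrow> 0"
proof -
  have "(central n)\<^sup>2 \<le> inverse (real (Suc n))" for n
  proof -
    have "real (Suc n) * (central n)\<^sup>2 \<le> (2 * real n + 1) * (central n)\<^sup>2"
      by (intro mult_right_mono) auto
    then have "real (Suc n) * (central n)\<^sup>2 \<le> 1"
      using central_square_le[of n] by linarith
    then show ?thesis by (simp add: field_simps)
  qed
  then have "(\<lambda>n. (central n)\<^sup>2) \<longlonglongrightarrow> 0"
    by (intro tendsto_sandwich[OF _ _ tendsto_const LIMSEQ_inverse_real_of_nat]) auto
  then show ?thesis by (simp add: tendsto_null_power)
qed

text \<open>For a uniform tree of size \<open>Suc n\<close>, the left subtree has size at most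
  \<open>k0\<close> with probability at least \<open>(1 - central (Suc k0)) / 2\<close>, uniformly
  in \<open>n\<close>. Each summand is bounded below through
  \<open>catalan (Suc n) \<le> 4 ^ Suc k * catalan (n - k)\<close>, and \<open>sum_catalan\<close>
  adds up the bounds.\<close>

lemma sum_small_left_ge:
  assumes "k0 \<le> n"
  shows "(1 - central (Suc k0)) * catalan (Suc n) \<le> 2 * (\<Sum>k\<le>k0. catalan k * catalan (n - k))"
proof -
  have "(1 - central (Suc k0)) * catalan (Suc n) = (\<Sum>k\<le>k0. catalan k * (catalan (Suc n) / 4 ^ k)) / 2"
  proof -
    have "(\<Sum>k\<le>k0. catalan k * (catalan (Suc n) / 4 ^ k)) =
        (\<Sum>k<Suc k0. catalan k / 4 ^ k) * catalan (Suc n)"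
      unfolding sum_distrib_right by (intro sum.cong) auto
    then show ?thesis by (simp only: sum_catalan)
  qed
  also have "\<dots> \<le> (\<Sum>k\<le>k0. catalan k * (4 * catalan (n - k))) / 2"
  proof (intro divide_right_mono sum_mono mult_left_mono)
    fix k assume "k \<in> {..k0}"
    then have "catalan (Suc n) \<le> 4 ^ Suc k * catalan (n - k)"
      using catalan_add_le[of "n - k" "Suc k"] assms by simp
    then show "catalan (Suc n) / 4 ^ k \<le> 4 * catalan (n - k)" by (simp add: field_simps)
  qed (auto intro: less_imp_le catalan_pos)
  also have "\<dots> = 2 * (\<Sum>k\<le>k0. catalan k * catalan (n - k))"
    by (simp add: mult.left_commute[of _ 4] sum_distrib_left[symmetric])
  finally show ?thesis .
qed

section \<open>Leaves of one random tree below a leaf of another\<close>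

text \<open>The number of nodes at depth \<open>i\<close>, leaves included. Divided by
  \<open>2 ^ i\<close> it is the probability that \<open>i\<close> fair left-or-right steps from the
  root stay in the tree.\<close>

fun level :: "nat \<Rightarrow> unit tree \<Rightarrow> nat" where
  "level 0 t = 1"
| "level (Suc i) Leaf = 0"
| "level (Suc i) \<langle>l, u, r\<rangle> = level i l + level i r"

lemma sum_level_Suc:
  "(\<Sum>t\<in>trees (Suc n). real (level (Suc i) t)) =
    2 * (\<Sum>k\<le>n. (\<Sum>t\<in>trees k. real (level i t)) * catalan (n - k))"
proof -
  have "(\<Sum>t\<in>trees (Suc n). real (level (Suc i) t)) =
      (\<Sum>k\<le>n. (\<Sum>t\<in>trees k. real (level i t)) * catalan (n - k)) +
      (\<Sum>k\<le>n. catalan k * (\<Sum>t\<in>trees (n - k). real (level i t)))"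
    by (simp add: sum_trees_Suc sum.distrib catalan_def sum_distrib_left mult_ac)
  also have "(\<Sum>k\<le>n. catalan k * (\<Sum>t\<in>trees (n - k). real (level i t))) =
      (\<Sum>k\<le>n. (\<Sum>t\<in>trees k. real (level i t)) * catalan (n - k))"
    by (rule sum.reindex_bij_witness[where i = "\<lambda>k. n - k" and j = "\<lambda>k. n - k"]) auto
  finally show ?thesis by simp
qed

text \<open>The left subtree of the root is a leaf with probability at least \<open>1/4\<close>, which cuts
  the trivial growth rate \<open>2\<close> of the levels down to \<open>3/2\<close>.\<close>

lemma sum_level_le: "(\<Sum>t\<in>trees n. real (level i t)) \<le> 2 * (3/2) ^ i * catalan n"
proof (induction i arbitrary: n)
  case 0
  then show ?case by (simp add: catalan_def)
next
  case (Suc i)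
  have nonneg: "0 \<le> catalan k" for k using catalan_pos[of k] by simp
  show ?case
  proof (cases n)
    case 0
    then show ?thesis by simp
  next
    case n: (Suc m)
    show ?thesis
    proof (cases i)
      case 0
      \<comment> \<open>From level 0 to level 1 the count may really double; the leading 2 in the
        bound leaves room for this.\<close>
      have "(\<Sum>t\<in>trees n. real (level (Suc i) t)) = 2 * catalan n"
        unfolding n sum_level_Suc catalan_Suc[of m] by (simp add: 0 catalan_def)
      also have "\<dots> \<le> 3 * catalan n" using nonneg[of n] by simp
      finally show ?thesis by (simp add: 0)
    next
      case i: (Suc i')
      \<comment> \<open>Here \<open>i\<close> is positive, so a single leaf has no node at level
        \<open>i\<close> and the summand \<open>k = 0\<close> drops out.\<close>
      have "(\<Sum>t\<in>trees n. real (level (Suc i) t)) =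
          2 * (\<Sum>k\<in>{..m} - {0}. (\<Sum>t\<in>trees k. real (level i t)) * catalan (m - k))"
        unfolding n sum_level_Suc by (subst sum.remove[of _ 0]) (auto simp: i)
      also have "\<dots> \<le> 2 * (\<Sum>k\<in>{..m} - {0}. (2 * (3/2) ^ i * catalan k) * catalan (m - k))"
        using nonneg by (intro mult_left_mono sum_mono mult_right_mono Suc) auto
      also have "\<dots> = 4 * (3/2) ^ i * (\<Sum>k\<in>{..m} - {0}. catalan k * catalan (m - k))"
        by (simp add: sum_distrib_left mult_ac)
      also have "(\<Sum>k\<in>{..m} - {0}. catalan k * catalan (m - k)) = catalan n - catalan m"
        unfolding n catalan_Suc by (subst (2) sum.remove[of _ 0]) auto
      also have "4 * (3/2) ^ i * (catalan n - catalan m) \<le> 4 * (3/2) ^ i * (3/4 * catalan n)"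
        using catalan_Suc_le[of m] n by (intro mult_left_mono) auto
      finally show ?thesis by (simp add: mult_ac)
    qed
  qed
qed

text \<open>Some leaf of \<open>S\<close> has all but \<open>uncovered S R\<close> leaves of \<open>R\<close> below it.\<close>

fun uncovered :: "unit tree \<Rightarrow> unit tree \<Rightarrow> nat" where
  "uncovered Leaf R = 0"
| "uncovered \<langle>l, u, r\<rangle> Leaf = 1"
| "uncovered \<langle>l, u, r\<rangle> \<langle>l', u', r'\<rangle> =
     min (uncovered l l' + Suc (size r')) (uncovered r r' + Suc (size l'))"

lemma uncovered_le: "uncovered S R \<le> Suc (size R)"
  by (induction S R rule: uncovered.induct) auto

lemma finite_trees_filter [simp]: "finite {R :: unit tree. size R = n \<and> P R}"
  by (rule finite_subset[OF _ finite_trees[of n]]) auto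

lemma card_trees_filter:
  "real (card {R \<in> trees n. P R}) = (\<Sum>R\<in>trees n. of_bool (P R))"
  by (simp add: finite_trees Int_def)

text \<open>Fix \<open>S\<close> and let \<open>R\<close> be uniform. Except with probability
  \<open>\<delta> k0\<close>, one subtree at the root of a large \<open>R\<close> has size at most
  \<open>k0\<close>; discarding it costs at most \<open>Suc k0\<close> leaves, and the other subtree
  is again uniform given its size. Left and right are symmetric, so averaging over \<open>i\<close>
  descents leaves at most \<open>level i S / 2 ^ i\<close> for the event that \<open>S\<close> has
  not been left yet. The 2 in \<open>i + 2\<close> pays for an \<open>R\<close> that has become
  small.\<close>

lemma card_uncovered_le:
  defines "\<delta> k0 \<equiv> central (Suc k0)"
  shows "real (card {R \<in> trees n. uncovered S R > (i + 2) * Suc k0}) \<le>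
    (real i * \<delta> k0 + real (level i S) / 2 ^ i) * catalan n"
proof (induction i arbitrary: S n)
  case 0
  have "card {R \<in> trees n. uncovered S R > (0 + 2) * Suc k0} \<le> card (trees n)"
    by (intro card_mono finite_trees) auto
  then show ?case by (simp add: catalan_def)
next
  case (Suc i)
  have \<delta>: "\<delta> k0 \<ge> 0" by (simp add: \<delta>_def central_nonneg)
  have nonneg: "0 \<le> catalan k" for k using catalan_pos[of k] by simp
  define K where "K = (i + 2) * Suc k0"
  have K': "(Suc i + 2) * Suc k0 = K + Suc k0" by (simp add: K_def)
  define N where "N S n = real (card {R \<in> trees n. uncovered S R > K})" for S n
  define B where "B S = real i * \<delta> k0 + real (level i S) / 2 ^ i" for S
  have N: "N S n \<le> B S * catalan n" for S n
    using Suc.IH unfolding N_def B_def K_def .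
  have N': "N S n = (\<Sum>R\<in>trees n. of_bool (uncovered S R > K))" for S n
    unfolding N_def by (rule card_trees_filter)
  \<comment> \<open>A tree of size at most \<open>2 * k0 + 1\<close> has at most
    \<open>2 * Suc k0\<close> leaves, fewer than needed to pass the threshold. For larger trees the
    two subtrees cannot both have size at most \<open>k0\<close>.\<close>
  consider "S = Leaf" | l u r where "S = \<langle>l, u, r\<rangle>" "n \<le> 2 * k0 + 1"
    | l u r m where "S = \<langle>l, u, r\<rangle>" "n = Suc m" "2 * k0 + 1 \<le> m"
    by (cases S; cases n) force+
  then show ?case
  proof cases
    case 1
    then show ?thesis using \<delta> nonneg[of n] by simp
  next
    case 2
    have "\<not> uncovered S R > (Suc i + 2) * Suc k0" if "size R = n" for R
      using uncovered_le[of S R] that 2(2) by simp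
    then have "{R \<in> trees n. uncovered S R > (Suc i + 2) * Suc k0} = {}" by auto
    then show ?thesis using \<delta> nonneg[of n] by (simp only: card.empty) simp
  next
    case (3 l u r m)
    define w where "w = (\<Sum>k\<le>k0. catalan k * catalan (m - k))"
    have w_ge: "2 * w \<ge> (1 - \<delta> k0) * catalan n"
      using sum_small_left_ge[of k0 m] 3 by (simp add: \<delta>_def w_def)
    \<comment> \<open>Sizes \<open>k\<close> of the left subtree of \<open>R\<close>: left small,
      right small, neither small.\<close>
    define X where "X = {..k0}"
    define Y where "Y = {m - k0..m}"
    define Z where "Z = {..m} - X - Y"
    have split: "(\<Sum>k\<le>m. f k) = (\<Sum>k\<in>X. f k) + (\<Sum>k\<in>Y. f k) + (\<Sum>k\<in>Z. f k)"
      for f :: "nat \<Rightarrow> real"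
    proof -
      have "{..m} = X \<union> Y \<union> Z" "X \<inter> Y = {}" "(X \<union> Y) \<inter> Z = {}"
        using 3(3) by (auto simp: X_def Y_def Z_def)
      then show ?thesis
        using sum.union_disjoint[of "X \<union> Y" Z f] sum.union_disjoint[of X Y f]
        by (simp add: X_def Y_def Z_def)
    qed
    have wY: "(\<Sum>k\<in>Y. catalan k * catalan (m - k)) = w"
      unfolding w_def Y_def using 3(3)
      by (intro sum.reindex_bij_witness[where i = "\<lambda>k. m - k" and j = "\<lambda>k. m - k"]) auto
    have wX: "(\<Sum>k\<in>X. catalan k * catalan (m - k)) = w" by (simp add: X_def w_def)
    have wZ: "(\<Sum>k\<in>Z. catalan k * catalan (m - k)) = catalan n - 2 * w"
      using split[of "\<lambda>k. catalan k * catalan (m - k)"] 3(2) wX wY by (simp add: catalan_Suc)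
    define F where "F k = (\<Sum>l'\<in>trees k. \<Sum>r'\<in>trees (m - k).
      of_bool (uncovered S \<langle>l', (), r'\<rangle> > K + Suc k0) :: real)" for k
    \<comment> \<open>For \<open>k\<close> in \<open>X\<close> the second argument of the minimum is
      used: going right costs \<open>Suc k\<close>, at most \<open>Suc k0\<close>. On
      \<open>Y\<close> the first argument is used.\<close>
    have "F k \<le> (\<Sum>l'\<in>trees k. \<Sum>r'\<in>trees (m - k). of_bool (uncovered r r' > K))" if "k \<in> X" for k
      unfolding F_def using that by (intro sum_mono) (auto simp: 3(1) X_def)
    also have "(\<Sum>l'\<in>trees k. \<Sum>r'\<in>trees (m - k). of_bool (uncovered r r' > K)) =
        catalan k * N r (m - k)" for k
      unfolding N' by (simp add: catalan_def)
    finally have "(\<Sum>k\<in>X. F k) \<le> (\<Sum>k\<in>X. catalan k * N r (m - k))"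
      by (rule sum_mono)
    also have "\<dots> \<le> (\<Sum>k\<in>X. catalan k * (B r * catalan (m - k)))"
      by (intro sum_mono mult_left_mono N nonneg)
    also have "\<dots> = w * B r"
      unfolding wX[symmetric] sum_distrib_right by (simp add: mult_ac)
    finally have FX: "(\<Sum>k\<in>X. F k) \<le> w * B r" .
    have "F k \<le> (\<Sum>l'\<in>trees k. \<Sum>r'\<in>trees (m - k). of_bool (uncovered l l' > K))" if "k \<in> Y" for k
      unfolding F_def using that by (intro sum_mono) (auto simp: 3(1) Y_def)
    also have "(\<Sum>l'\<in>trees k. \<Sum>r'\<in>trees (m - k). of_bool (uncovered l l' > K)) =
        N l k * catalan (m - k)" for k
      unfolding N' sum_distrib_right by (simp add: catalan_def mult.commute)
    finally have "(\<Sum>k\<in>Y. F k) \<le> (\<Sum>k\<in>Y. N l k * catalan (m - k))"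
      by (rule sum_mono)
    also have "\<dots> \<le> (\<Sum>k\<in>Y. B l * catalan k * catalan (m - k))"
      by (intro sum_mono mult_right_mono N nonneg)
    also have "\<dots> = w * B l"
      unfolding wY[symmetric] sum_distrib_right by (simp add: mult_ac)
    finally have FY: "(\<Sum>k\<in>Y. F k) \<le> w * B l" .
    \<comment> \<open>On \<open>Z\<close> every tree is counted as bad; the weight of
      \<open>Z\<close> is at most \<open>\<delta> k0 * catalan n\<close>.\<close>
    have "F k \<le> (\<Sum>l'\<in>trees k. \<Sum>r'\<in>trees (m - k). 1)" for k
      unfolding F_def by (intro sum_mono) auto
    then have "F k \<le> catalan k * catalan (m - k)" for k
      by (simp add: catalan_def)
    then have FZ: "(\<Sum>k\<in>Z. F k) \<le> catalan n - 2 * w"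
      unfolding wZ[symmetric] by (intro sum_mono)
    have "0 \<le> (\<Sum>k\<in>Z. catalan k * catalan (m - k))"
      by (intro sum_nonneg mult_nonneg_nonneg nonneg)
    then have w_le: "2 * w \<le> catalan n" unfolding wZ by simp
    have B: "0 \<le> B l" "0 \<le> B r" using \<delta> by (simp_all add: B_def)
    have "real (card {R \<in> trees n. uncovered S R > (Suc i + 2) * Suc k0}) = (\<Sum>k\<le>m. F k)"
      unfolding K' card_trees_filter unfolding 3(2) sum_trees_Suc F_def ..
    also have "\<dots> \<le> w * B r + w * B l + (catalan n - 2 * w)"
      unfolding split using FX FY FZ by simp
    also have "\<dots> = w * (B l + B r) + (catalan n - 2 * w)" by (simp add: algebra_simps)
    also have "\<dots> \<le> (catalan n / 2) * (B l + B r) + \<delta> k0 * catalan n"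
      using w_le w_ge B by (intro add_mono mult_right_mono) (auto simp: algebra_simps)
    also have "\<dots> = (real (Suc i) * \<delta> k0 + real (level (Suc i) S) / 2 ^ Suc i) * catalan n"
      by (simp add: B_def 3(1) field_simps)
    finally show ?thesis .
  qed
qed

text \<open>Averaging over \<open>S\<close> too turns \<open>level i S / 2 ^ i\<close> into at most
  \<open>2 * (3/4) ^ i\<close>. First \<open>i\<close> is chosen to make this small, then
  \<open>k0\<close> depending on \<open>i\<close>; neither depends on the sizes, so one
  \<open>K\<close> serves all \<open>m\<close> and \<open>n\<close>.\<close>

lemma card_uncovered_pairs:
  assumes "\<epsilon> > 0"
  obtains K where "\<And>m n. real (card {(S, R). size S = m \<and> size R = n \<and> uncovered S R > K})
    \<le> \<epsilon> * catalan m * catalan n"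
proof -
  have "(\<lambda>i. 2 * (3/4 :: real) ^ i) \<longlonglongrightarrow> 2 * 0"
    by (intro tendsto_intros) auto
  then have "eventually (\<lambda>i. 2 * (3/4 :: real) ^ i < \<epsilon> / 2) sequentially"
    using assms by (elim order_tendstoD) auto
  then obtain i where i: "2 * (3/4 :: real) ^ i < \<epsilon> / 2"
    unfolding eventually_sequentially by blast
  have "(\<lambda>k. real i * central (Suc k)) \<longlonglongrightarrow> real i * 0"
    by (intro tendsto_intros LIMSEQ_Suc central_tendsto_0)
  then have "eventually (\<lambda>k. real i * central (Suc k) < \<epsilon> / 2) sequentially"
    using assms by (elim order_tendstoD) auto
  then obtain k0 where k0: "real i * central (Suc k0) < \<epsilon> / 2"
    unfolding eventually_sequentially by blast
  define K where "K = (i + 2) * Suc k0"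
  show ?thesis
  proof (rule that[of K])
    fix m n
    have "{(S, R). size S = m \<and> size R = n \<and> uncovered S R > K} =
        (SIGMA S:trees m. {R \<in> trees n. uncovered S R > K})" by auto
    then have "real (card {(S, R). size S = m \<and> size R = n \<and> uncovered S R > K}) =
        (\<Sum>S\<in>trees m. real (card {R \<in> trees n. uncovered S R > K}))"
      by (simp add: finite_trees)
    also have "\<dots> \<le> (\<Sum>S\<in>trees m. (real i * central (Suc k0) + real (level i S) / 2 ^ i) * catalan n)"
      unfolding K_def by (intro sum_mono card_uncovered_le)
    also have "\<dots> = (real i * central (Suc k0) * catalan m +
        (\<Sum>S\<in>trees m. real (level i S)) / 2 ^ i) * catalan n"
      by (simp add: sum_distrib_right[symmetric] sum.distrib catalan_def sum_divide_distrib)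
    also have "\<dots> \<le> (\<epsilon> / 2 * catalan m + \<epsilon> / 2 * catalan m) * catalan n"
    proof (intro mult_right_mono add_mono)
      have "(\<Sum>S\<in>trees m. real (level i S)) / 2 ^ i \<le> 2 * (3/2) ^ i * catalan m / 2 ^ i"
        by (intro divide_right_mono sum_level_le) simp
      also have "\<dots> = 2 * (3/4) ^ i * catalan m"
        by (simp add: power_divide power_mult_distrib[symmetric])
      also have "\<dots> \<le> \<epsilon> / 2 * catalan m"
        using i catalan_pos[of m] by (intro mult_right_mono) auto
      finally show "(\<Sum>S\<in>trees m. real (level i S)) / 2 ^ i \<le> \<epsilon> / 2 * catalan m" .
    qed (use k0 catalan_pos[of m] catalan_pos[of n] in auto)
    finally show "real (card {(S, R). size S = m \<and> size R = n \<and> uncovered S R > K})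
        \<le> \<epsilon> * catalan m * catalan n" by simp
  qed
qed

section \<open>Nested dyadic intervals\<close>

definition subinterval :: "real \<times> real \<Rightarrow> real \<times> real \<Rightarrow> bool" where
  "subinterval J I \<longleftrightarrow> fst I \<le> fst J \<and> snd J \<le> snd I"

text \<open>The induction follows the recursion of \<open>uncovered\<close>: the minimum selects the
  half in which to look for the leaf, and all leaves of \<open>R\<close> in the other half are given
  up.\<close>

lemma exists_covering_interval:
  assumes "a < b"
  shows "\<exists>I\<in>set (leaf_intervals a b S).
    length (filter (\<lambda>J. \<not> subinterval J I) (leaf_intervals a b R)) \<le> uncovered S R"
  using assms
proof (induction S R arbitrary: a b rule: uncovered.induct)
  case (1 R)
  have "subinterval J (a, b)" if "J \<in> set (leaf_intervals a b R)" for J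
    using leaf_intervals_bounds[of "fst J" "snd J" a b R] that 1 by (simp add: subinterval_def)
  then show ?case by (simp add: filter_empty_conv)
next
  case (2 l u r)
  \<comment> \<open>\<open>R\<close> has a single leaf, which may stay uncovered, so any leaf of
    \<open>S\<close> will do.\<close>
  obtain I where "I \<in> set (leaf_intervals a b \<langle>l, u, r\<rangle>)"
    using length_leaf_intervals[of a b "\<langle>l, u, r\<rangle>"]
    by (metis length_greater_0_conv nth_mem zero_less_Suc)
  then show ?case by (intro bexI[of _ I]) auto
next
  case (3 l u r l' u' r')
  let ?M = "(a + b) / 2"
  have M: "a < ?M" "?M < b" using 3 by auto
  show ?case
  proof (cases "uncovered l l' + Suc (size r') \<le> uncovered r r' + Suc (size l')")
    case True
    obtain I where "I \<in> set (leaf_intervals a ?M l)"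
      "length (filter (\<lambda>J. \<not> subinterval J I) (leaf_intervals a ?M l')) \<le> uncovered l l'"
      using "3.IH"(1)[OF M(1)] by blast
    moreover have "length (filter (\<lambda>J. \<not> subinterval J I) (leaf_intervals ?M b r')) \<le> Suc (size r')"
      using length_filter_le by (metis length_leaf_intervals)
    ultimately show ?thesis using True by (intro bexI[of _ I]) auto
  next
    case False
    obtain I where "I \<in> set (leaf_intervals ?M b r)"
      "length (filter (\<lambda>J. \<not> subinterval J I) (leaf_intervals ?M b r')) \<le> uncovered r r'"
      using "3.IH"(2)[OF M(2)] by blast
    moreover have "length (filter (\<lambda>J. \<not> subinterval J I) (leaf_intervals a ?M l')) \<le> Suc (size l')"
      using length_filter_le by (metis length_leaf_intervals)
    ultimately show ?thesis using False by (intro bexI[of _ I]) auto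
  qed
qed

text \<open>Descend in both trees at once. Leaves in different halves are disjoint, and once one
  tree is a leaf its interval is the whole of \<open>[a, b)\<close> and contains the other.\<close>

lemma leaf_intervals_nested:
  assumes "I \<in> set (leaf_intervals a b S)" "J \<in> set (leaf_intervals a b R)" "a < b"
    and "fst I \<le> x" "x < snd I" "fst J \<le> x" "x < snd J"
  shows "subinterval I J \<or> subinterval J I"
  using assms
proof (induction S R arbitrary: a b rule: uncovered.induct)
  case (1 R)
  then show ?case
    using leaf_intervals_bounds[of "fst J" "snd J" a b R] by (auto simp: subinterval_def)
next
  case (2 l u r)
  then show ?case
    using leaf_intervals_bounds[of "fst I" "snd I" a b "\<langle>l, u, r\<rangle>"] by (auto simp: subinterval_def)
next
  case (3 l u r l' u' r')
  let ?M = "(a + b) / 2"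
  have M: "a < ?M" "?M < b" using 3 by auto
  have l: "snd H \<le> ?M" if "H \<in> set (leaf_intervals a ?M t)" for H t
    using leaf_intervals_bounds[of "fst H" "snd H" a ?M t] that M by simp
  have r: "?M \<le> fst H" if "H \<in> set (leaf_intervals ?M b t)" for H t
    using leaf_intervals_bounds[of "fst H" "snd H" ?M b t] that M by simp
  consider "I \<in> set (leaf_intervals a ?M l)" "J \<in> set (leaf_intervals a ?M l')"
    | "I \<in> set (leaf_intervals ?M b r)" "J \<in> set (leaf_intervals ?M b r')"
    | "I \<in> set (leaf_intervals a ?M l)" "J \<in> set (leaf_intervals ?M b r')"
    | "I \<in> set (leaf_intervals ?M b r)" "J \<in> set (leaf_intervals a ?M l')"
    using 3 by auto
  then show ?case
  proof cases
    case 1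
    then show ?thesis using "3.IH"(1) M "3.prems" by blast
  next
    case 2
    then show ?thesis using "3.IH"(2) M "3.prems" by blast
  next
    case 3
    then show ?thesis using l[of I l] r[of J r'] "3.prems" by linarith
  next
    case 4
    then show ?thesis using l[of J l'] r[of I r] "3.prems" by linarith
  qed
qed

section \<open>Counting nested pairs of leaves by their indices\<close>

definition leaf_within :: "unit tree \<Rightarrow> nat \<Rightarrow> unit tree \<Rightarrow> nat \<Rightarrow> bool" where
  "leaf_within R j S i \<longleftrightarrow> leaf_left S i \<le> leaf_left R j \<and> leaf_right R j \<le> leaf_right S i"

lemma exists_covering_leaf:
  obtains i where "i \<le> size S" "card {j. j \<le> size R \<and> \<not> leaf_within R j S i} \<le> uncovered S R"
proof -
  obtain I where I: "I \<in> set (leaf_intervals 0 1 S)"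
    "length (filter (\<lambda>J. \<not> subinterval J I) (leaf_intervals 0 1 R)) \<le> uncovered S R"
    using exists_covering_interval[of 0 1 S R] by auto
  then obtain i where i: "i \<le> size S" "I = leaf_intervals 0 1 S ! i"
    by (auto simp: in_set_conv_nth less_Suc_eq_le)
  have "length (filter (\<lambda>J. \<not> subinterval J I) (leaf_intervals 0 1 R)) =
      card {j. j \<le> size R \<and> \<not> leaf_within R j S i}"
    by (simp add: length_filter_conv_card i(2) subinterval_def leaf_within_def leaf_left_def
        leaf_right_def less_Suc_eq_le)
  then show ?thesis using that i(1) I(2) by metis
qed

lemma leaf_unique:
  assumes "i \<le> size t" "j \<le> size t" "x \<in> {leaf_left t i..<leaf_right t i}"
    "x \<in> {leaf_left t j..<leaf_right t j}"
  shows "i = j"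
proof -
  have "x \<in> {0..<1}" using leaf_bounds[OF assms(1)] assms(3) by auto
  from leaf_ex1[OF this, of t] show ?thesis using assms by blast
qed

lemma leaf_left_inject:
  assumes "i \<le> size t" "j \<le> size t" "leaf_left t i = leaf_left t j"
  shows "i = j"
  using leaf_unique[OF assms(1,2), of "leaf_left t i"] leaf_bounds(2)[OF assms(1)]
    leaf_bounds(2)[OF assms(2)] assms(3) by simp

lemma leaf_right_inject:
  assumes "i \<le> size t" "j \<le> size t" "leaf_right t i = leaf_right t j"
  shows "i = j"
  using leaf_unique[OF assms(1,2), of "max (leaf_left t i) (leaf_left t j)"]
    leaf_bounds[OF assms(1)] leaf_bounds[OF assms(2)] assms(3) by (auto simp: max_def)

lemma leaf_within_unique:
  assumes "leaf_within R j S i" "leaf_within R j S i'" "i \<le> size S" "i' \<le> size S" "j \<le> size R"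
  shows "i = i'"
  using leaf_unique[OF assms(3,4), of "leaf_left R j"] assms leaf_bounds[OF assms(5)]
  by (auto simp: leaf_within_def)

lemma leaf_nested:
  assumes "i \<le> size S" "j \<le> size R" "x \<in> {leaf_left S i..<leaf_right S i}"
    "x \<in> {leaf_left R j..<leaf_right R j}"
  shows "leaf_within S i R j \<or> leaf_within R j S i"
  using leaf_intervals_nested[OF leaf_in_set[OF assms(1)] leaf_in_set[OF assms(2)], of x] assms(3,4)
  by (simp add: subinterval_def leaf_within_def)

text \<open>Strictness at both ends puts the fixed point of the contraction in the interior of the
  interval, where it has a two-sided neighbourhood.\<close>

definition leaf_inside :: "unit tree \<Rightarrow> nat \<Rightarrow> unit tree \<Rightarrow> nat \<Rightarrow> bool" where
  "leaf_inside R j S i \<longleftrightarrow> leaf_left S i < leaf_left R j \<and> leaf_right R j < leaf_right S i"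

lemma card_not_inside:
  assumes "i \<le> size S"
  shows "card {j. j \<le> size R \<and> \<not> leaf_inside R j S i} \<le>
    card {j. j \<le> size R \<and> \<not> leaf_within R j S i} + 2"
proof -
  let ?L = "{j. j \<le> size R \<and> leaf_left R j = leaf_left S i}"
  let ?R = "{j. j \<le> size R \<and> leaf_right R j = leaf_right S i}"
  have "card ?L \<le> 1"
    by (rule card_le_Suc0_iff_eq[THEN iffD2, unfolded One_nat_def[symmetric]])
      (auto intro: leaf_left_inject)
  moreover have "card ?R \<le> 1"
    by (rule card_le_Suc0_iff_eq[THEN iffD2, unfolded One_nat_def[symmetric]])
      (auto intro: leaf_right_inject)
  moreover have "card {j. j \<le> size R \<and> \<not> leaf_inside R j S i} \<le>
      card ({j. j \<le> size R \<and> \<not> leaf_within R j S i} \<union> (?L \<union> ?R))"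
    by (intro card_mono) (auto simp: leaf_inside_def leaf_within_def)
  moreover have "\<dots> \<le> card {j. j \<le> size R \<and> \<not> leaf_within R j S i} + (card ?L + card ?R)"
    by (rule order.trans[OF card_Un_le add_left_mono[OF card_Un_le]])
  ultimately show ?thesis by linarith
qed

text \<open>A leaf \<open>j\<close> of \<open>R\<close> lies below at most one leaf of
  \<open>S\<close>, so \<open>j\<close> determines the pair; if that leaf is not \<open>u\<close>,
  then \<open>j\<close> is not below \<open>u\<close>.\<close>

lemma card_within_other:
  assumes "u \<le> size S"
  shows "card {(i, j). i \<le> size S \<and> j \<le> size R \<and> i \<noteq> u \<and> leaf_within R j S i} \<le>
    card {j. j \<le> size R \<and> \<not> leaf_within R j S u}"
  by (rule card_inj_on_le[where f = snd])
    (use assms in \<open>auto intro!: inj_onI dest: leaf_within_unique\<close>)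

text \<open>A pair \<open>(i, j)\<close> stands for sending leaf \<open>i\<close> of
  \<open>S\<close> to leaf \<open>j\<close> of \<open>R\<close>. The first two sets spoil the
  attracting point in \<open>u\<close> or the repelling point in \<open>v\<close>; the last two
  could create further fixed points.\<close>

definition bad_pairs :: "unit tree \<Rightarrow> unit tree \<Rightarrow> nat \<Rightarrow> nat \<Rightarrow> (nat \<times> nat) set" where
  "bad_pairs S R u v =
     {u} \<times> {j. j \<le> size R \<and> \<not> leaf_inside R j S u} \<union>
     {i. i \<le> size S \<and> \<not> leaf_inside S i R v} \<times> {v} \<union>
     {(i, j). i \<le> size S \<and> j \<le> size R \<and> i \<noteq> u \<and> leaf_within R j S i} \<union>
     {(i, j). i \<le> size S \<and> j \<le> size R \<and> j \<noteq> v \<and> leaf_within S i R j}"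

lemma finite_bad_pairs: "finite (bad_pairs S R u v)"
  by (rule finite_subset[of _ "insert u {..size S} \<times> insert v {..size R}"])
    (auto simp: bad_pairs_def)

lemma card_bad_pairs:
  assumes "u \<le> size S" "v \<le> size R"
    and "card {j. j \<le> size R \<and> \<not> leaf_within R j S u} \<le> K"
    and "card {i. i \<le> size S \<and> \<not> leaf_within S i R v} \<le> K"
  shows "card (bad_pairs S R u v) \<le> 4 * K + 4"
proof -
  let ?A = "{u} \<times> {j. j \<le> size R \<and> \<not> leaf_inside R j S u}"
  let ?B = "{i. i \<le> size S \<and> \<not> leaf_inside S i R v} \<times> {v}"
  let ?C = "{(i, j). i \<le> size S \<and> j \<le> size R \<and> i \<noteq> u \<and> leaf_within R j S i}"
  let ?D = "{(i, j). i \<le> size S \<and> j \<le> size R \<and> j \<noteq> v \<and> leaf_within S i R j}"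
  have "card ?A \<le> K + 2" "card ?B \<le> K + 2"
    using card_not_inside[OF assms(1), of R] card_not_inside[OF assms(2), of S] assms(3,4)
    by (auto simp: card_cartesian_product)
  moreover have "card ?C \<le> K" using card_within_other[OF assms(1), of R] assms(3) by linarith
  moreover have "?D = prod.swap ` {(j, i). j \<le> size R \<and> i \<le> size S \<and> j \<noteq> v \<and> leaf_within S i R j}"
    by (auto simp: image_iff)
  then have "card ?D \<le> K"
    using card_within_other[OF assms(2), of S] assms(4) by (simp add: card_image)
  moreover have "card (bad_pairs S R u v) \<le> ((card ?A + card ?B) + card ?C) + card ?D"
    unfolding bad_pairs_def
    by (intro order.trans[OF card_Un_le add_right_mono] card_Un_le)
  ultimately show ?thesis by linarith
qed

section \<open>Contractions on the circle\<close>

text \<open>An open arc is cut out of the unit circle by a half-plane: after rotating its centre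
  \<open>c\<close> to angle 0, it consists of the points with real part above
  \<open>cos (2 * pi * h)\<close>, where \<open>h\<close> is half its length.\<close>

lemma openin_circle_interval:
  assumes "0 \<le> a" "b \<le> 1"
  shows "openin circle_topology {a<..<b}"
proof (cases "a < b")
  case True
  define c where "c = (a + b) / 2"
  define h where "h = (b - a) / 2"
  define U where "U = {z. Re (z * cis (- (2 * pi * c))) > cos (2 * pi * h)}"
  have h: "0 < h" "h \<le> c" "c \<le> 1 - h" using assms True by (auto simp: c_def h_def field_simps)
  have "open U"
    unfolding U_def by (intro open_Collect_less continuous_intros)
  moreover have "cis (2 * pi * t) \<in> U \<longleftrightarrow> t \<in> {a<..<b}" if t: "t \<in> {0..<1}" for t
  proof -
    define s where "s = \<bar>t - c\<bar>"
    have s: "0 \<le> s" "s \<le> 1 - h" using t h by (auto simp: s_def)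
    have "Re (cis (2 * pi * t) * cis (- (2 * pi * c))) = cos (2 * pi * (t - c))"
      by (simp add: cis_mult algebra_simps)
    also have "\<dots> = cos (2 * pi * s)"
      by (auto simp: s_def abs_if) (metis cos_minus minus_diff_eq mult_minus_right)
    finally have "cis (2 * pi * t) \<in> U \<longleftrightarrow> cos (2 * pi * h) < cos (2 * pi * s)"
      by (simp add: U_def)
    also have "\<dots> \<longleftrightarrow> s < h"
    proof
      assume "s < h"
      then show "cos (2 * pi * h) < cos (2 * pi * s)"
        using s h by (intro cos_monotone_0_pi) auto
    next
      assume less: "cos (2 * pi * h) < cos (2 * pi * s)"
      show "s < h"
      proof (rule ccontr)
        assume "\<not> s < h"
        have "cos (2 * pi * s) \<le> cos (2 * pi * h)"
        proof (cases "s \<le> 1/2")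
          case True
          then show ?thesis using \<open>\<not> s < h\<close> h by (intro cos_monotone_0_pi_le) auto
        next
          \<comment> \<open>Beyond half a turn the distance is measured the other way round the
            circle, as \<open>1 - s\<close>, which is still at least \<open>h\<close>.\<close>
          case False
          have "cos (2 * pi * s) = cos (2 * pi - 2 * pi * s)" by simp
          also have "\<dots> = cos (2 * pi * (1 - s))" by (simp only: right_diff_distrib mult_1_right)
          also have "\<dots> \<le> cos (2 * pi * h)"
            using False s h by (intro cos_monotone_0_pi_le) auto
          finally show ?thesis .
        qed
        with less show False by simp
      qed
    qed
    also have "\<dots> \<longleftrightarrow> t \<in> {a<..<b}" by (auto simp: s_def c_def h_def abs_if field_simps)
    finally show ?thesis .
  qed
  then have "{a<..<b} = (\<lambda>t. cis (2 * pi * t)) -` U \<inter> {0..<1}"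
    using assms by auto
  ultimately show ?thesis
    unfolding circle_topology_def openin_pullback_topology by auto
next
  case False
  then have "{a<..<b} = {}" by simp
  then show ?thesis by (simp only: openin_empty)
qed

text \<open>The iterates are explicit, \<open>p + \<kappa> ^ m * (x - p)\<close>, and by convexity
  never leave the interval.\<close>

lemma attracting_contraction:
  assumes "0 \<le> a" "b \<le> 1" "p \<in> {a<..<b}" "0 \<le> \<kappa>" "\<kappa> < 1"
    and h: "\<And>x. x \<in> {a<..<b} \<Longrightarrow> h x = p + \<kappa> * (x - p)"
  shows "attracting h p"
  unfolding attracting_def
proof (intro exI[of _ "{a<..<b}"] conjI ballI)
  show "openin circle_topology {a<..<b}" using assms by (intro openin_circle_interval)
  fix x assume x: "x \<in> {a<..<b}"
  have between: "p + r * (x - p) \<in> {a<..<b}" if "0 \<le> r" "r \<le> 1" for r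
  proof -
    have "(1 - r) *\<^sub>R p + r *\<^sub>R x \<in> {a<..<b}"
      using assms(3) x that by (intro convexD[OF convex_real_interval(8)]) auto
    then show ?thesis by (simp add: algebra_simps)
  qed
  have iter: "(h ^^ m) x = p + \<kappa> ^ m * (x - p)" for m
  proof (induction m)
    case (Suc m)
    have "p + \<kappa> ^ m * (x - p) \<in> {a<..<b}"
      using assms by (intro between) (auto intro: power_le_one)
    then show ?case using Suc h by simp
  qed simp
  have "(\<lambda>m. cis (2 * pi * (p + \<kappa> ^ m * (x - p)))) \<longlonglongrightarrow> cis (2 * pi * (p + 0 * (x - p)))"
    using assms by (intro tendsto_intros) auto
  moreover have "p + \<kappa> ^ m * (x - p) \<in> {0..<1}" for m
    using between[of "\<kappa> ^ m"] power_le_one[of \<kappa> m] assms by auto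
  ultimately show "limitin circle_topology (\<lambda>m. (h ^^ m) x) p sequentially"
    unfolding limitin_circle iter using assms by auto
qed (use assms in auto)

text \<open>Applied below both to the map on leaf \<open>u\<close> and to its inverse on leaf
  \<open>v\<close>. The point \<open>p\<close> solves \<open>p = c + \<kappa> * (p - a)\<close>; the
  strict inclusion of the image makes its distances to \<open>a\<close> and \<open>b\<close>
  positive.\<close>

lemma affine_contraction_fixed_point:
  fixes a b c d :: real
  assumes "0 \<le> a" "b \<le> 1" "a < c" "c < d" "d < b"
    and h: "\<And>x. x \<in> {a..<b} \<Longrightarrow> h x = c + (d - c) / (b - a) * (x - a)"
  obtains p where "p \<in> {c<..<d}" "attracting h p" "\<And>x. x \<in> {a..<b} \<Longrightarrow> h x = x \<longleftrightarrow> x = p"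
proof -
  define \<kappa> where "\<kappa> = (d - c) / (b - a)"
  have \<kappa>: "0 < \<kappa>" "\<kappa> < 1" using assms by (auto simp: \<kappa>_def)
  have d: "d = c + \<kappa> * (b - a)" using assms by (simp add: \<kappa>_def)
  define p where "p = (c - \<kappa> * a) / (1 - \<kappa>)"
  have p: "p - a = (c - a) / (1 - \<kappa>)" "b - p = (b - d) / (1 - \<kappa>)" "p = c + \<kappa> * (p - a)"
    using \<kappa> unfolding p_def d by (simp_all add: field_simps)
  have "p - a > 0" "b - p > 0" unfolding p(1,2) using assms \<kappa> by auto
  then have pab: "p \<in> {a<..<b}" by simp
  have "\<kappa> * (p - a) > 0" "\<kappa> * (p - a) < \<kappa> * (b - a)"
    using pab \<kappa> by (auto intro!: mult_pos_pos mult_strict_left_mono)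
  then have pcd: "p \<in> {c<..<d}" using p(3) d by auto
  have hp: "h x = p + \<kappa> * (x - p)" if "x \<in> {a..<b}" for x
  proof -
    have "h x = c + \<kappa> * (p - a) + \<kappa> * (x - p)"
      using h[OF that] by (simp add: \<kappa>_def[symmetric] algebra_simps)
    then show ?thesis using p(3) by simp
  qed
  show ?thesis
  proof (rule that[OF pcd])
    show "attracting h p"
      using assms pab \<kappa> hp by (intro attracting_contraction[of a b p \<kappa> h]) auto
    show "h x = x \<longleftrightarrow> x = p" if "x \<in> {a..<b}" for x
    proof -
      have "h x = x \<longleftrightarrow> (1 - \<kappa>) * (x - p) = 0"
        unfolding hp[OF that] by (auto simp: algebra_simps)
      then show ?thesis using \<kappa> by simp
    qed
  qed
qed

text \<open>Outside of \<open>bad_pairs\<close>, a leaf meets its image only if it is \<open>u\<close>, which is contracted,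
  or is sent to \<open>v\<close> and expanded.\<close>

lemma north_south_if_no_bad_pair:
  assumes D: "(S, R, \<pi>) \<in> diagrams n" and uv: "u \<le> n" "v \<le> n"
    and good: "\<And>i. i \<le> n \<Longrightarrow> (i, \<pi> i) \<notin> bad_pairs S R u v"
  shows "north_south (diagram_map (S, R, \<pi>))"
proof -
  define g where "g = diagram_map (S, R, \<pi>)"
  have sz: "size S = n" "size R = n" and perm: "\<pi> permutes {..n}"
    using D by (auto simp: diagrams_def)
  have \<pi>_le: "\<pi> i \<le> n" if "i \<le> n" for i using permutes_in_image[OF perm, of i] that by simp
  define w where "w = inv \<pi> v"
  have w: "\<pi> w = v" "w \<le> n"
    using permutes_inverses(1)[OF perm] permutes_in_image[OF permutes_inv[OF perm], of v] uv
    by (simp_all add: w_def)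
  have in_u: "leaf_inside R (\<pi> u) S u"
    using good[OF uv(1)] \<pi>_le[OF uv(1)] sz by (auto simp: bad_pairs_def)
  have in_v: "leaf_inside S w R v"
    using good[OF w(2)] w sz by (auto simp: bad_pairs_def)
  \<comment> \<open>If \<open>u\<close> were sent to \<open>v\<close>, each of the two intervals
    would lie strictly inside the other.\<close>
  have "u \<noteq> w" using in_u in_v w(1) by (auto simp: leaf_inside_def)
  have bij: "bij_betw g {0..<1} {0..<1}"
    unfolding g_def by (rule diagram_map_bij_betw[OF D])
  have g_eq: "g x = leaf_left R (\<pi> i) +
      (leaf_right R (\<pi> i) - leaf_left R (\<pi> i)) / (leaf_right S i - leaf_left S i) *
        (x - leaf_left S i)"
    if "i \<le> n" "x \<in> {leaf_left S i..<leaf_right S i}" for i x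
    unfolding g_def using that sz by (intro diagram_map_eq) auto
  note bS = leaf_bounds[of _ S, unfolded sz] and bR = leaf_bounds[of _ R, unfolded sz]
  obtain p where p: "p \<in> {leaf_left R (\<pi> u)<..<leaf_right R (\<pi> u)}" "attracting g p"
    "\<And>x. x \<in> {leaf_left S u..<leaf_right S u} \<Longrightarrow> g x = x \<longleftrightarrow> x = p"
    using affine_contraction_fixed_point[of "leaf_left S u" "leaf_right S u"
        "leaf_left R (\<pi> u)" "leaf_right R (\<pi> u)" g]
      bS[OF uv(1)] bR[OF \<pi>_le[OF uv(1)]] g_eq[OF uv(1)] in_u
    unfolding leaf_inside_def by blast
  have inv_g: "inv_into {0..<1} g y = leaf_left S w +
      (leaf_right S w - leaf_left S w) / (leaf_right R v - leaf_left R v) * (y - leaf_left R v)"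
    if y: "y \<in> {leaf_left R v..<leaf_right R v}" for y
  proof (rule inv_into_f_eq[OF bij_betw_imp_inj_on[OF bij]])
    let ?x = "leaf_left S w +
      (leaf_right S w - leaf_left S w) / (leaf_right R v - leaf_left R v) * (y - leaf_left R v)"
    have x: "?x \<in> {leaf_left S w..<leaf_right S w}"
      using bij_betw_apply[OF affine_bij_betw y] bS[OF w(2)] bR[OF uv(2)] by blast
    then show "?x \<in> {0..<1}" using bS[OF w(2)] by auto
    show "g ?x = y"
      using g_eq[OF w(2) x] bS(2)[OF w(2)] bR(2)[OF uv(2)] by (simp add: w(1))
  qed
  obtain q where q: "q \<in> {leaf_left S w<..<leaf_right S w}" "attracting (inv_into {0..<1} g) q"
    "\<And>x. x \<in> {leaf_left R v..<leaf_right R v} \<Longrightarrow> inv_into {0..<1} g x = x \<longleftrightarrow> x = q"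
    using affine_contraction_fixed_point[of "leaf_left R v" "leaf_right R v"
        "leaf_left S w" "leaf_right S w" "inv_into {0..<1} g"]
      bS[OF w(2)] bR[OF uv(2)] inv_g in_v
    unfolding leaf_inside_def by blast
  have pu: "p \<in> {leaf_left S u..<leaf_right S u}" using p(1) in_u by (auto simp: leaf_inside_def)
  have qv: "q \<in> {leaf_left R v..<leaf_right R v}" using q(1) in_v by (auto simp: leaf_inside_def)
  have p01: "p \<in> {0..<1}" using pu bS[OF uv(1)] by auto
  have q01: "q \<in> {0..<1}" using qv bR[OF uv(2)] by auto
  have inv_fix: "g x = x \<longleftrightarrow> inv_into {0..<1} g x = x" if "x \<in> {0..<1}" for x
    using bij that
    by (metis bij_betw_imp_inj_on bij_betw_imp_surj_on f_inv_into_f inv_into_f_eq)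
  \<comment> \<open>The two points lie in different leaves \<open>u\<close> and \<open>w\<close> of
    \<open>S\<close>.\<close>
  have "p \<noteq> q"
    using leaf_unique[of u S w p] pu q(1) uv(1) w(2) sz \<open>u \<noteq> w\<close> by auto
  moreover have "{x \<in> {0..<1}. g x = x} = {p, q}"
  proof (intro equalityI subsetI)
    fix x assume "x \<in> {p, q}"
    then show "x \<in> {x \<in> {0..<1}. g x = x}"
      using p01 q01 p(3)[OF pu] q(3)[OF qv] inv_fix by auto
  next
    fix x assume x: "x \<in> {x \<in> {0..<1}. g x = x}"
    then obtain i where i: "i \<le> n" "x \<in> {leaf_left S i..<leaf_right S i}"
      using leaf_ex1[of x S] sz by auto
    \<comment> \<open>A fixed point lies in a leaf of \<open>S\<close> and in the image of that
      leaf, so these two dyadic intervals are nested.\<close>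
    have "g x \<in> {leaf_left R (\<pi> i)..<leaf_right R (\<pi> i)}"
      unfolding g_def by (rule bij_betw_apply[OF diagram_map_bij_betw_leaf[OF D i(1)] i(2)])
    then have ix: "x \<in> {leaf_left R (\<pi> i)..<leaf_right R (\<pi> i)}" using x by simp
    have "leaf_within S i R (\<pi> i) \<or> leaf_within R (\<pi> i) S i"
      using i ix \<pi>_le[OF i(1)] sz by (intro leaf_nested) auto
    then have "i = u \<or> \<pi> i = v"
      using good[OF i(1)] \<pi>_le[OF i(1)] i(1) sz by (auto simp: bad_pairs_def)
    then show "x \<in> {p, q}"
      using p(3)[of x] q(3)[of x] i(2) ix x inv_fix[of x] by auto
  qed
  ultimately show ?thesis
    using bij p(2) q(2) unfolding north_south_def g_def[symmetric] by blast
qed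

section \<open>Random bijections\<close>

text \<open>A union bound: each prescribed value \<open>\<pi> i = j\<close> is taken by at most n!
  of the (n+1)! permutations.\<close>

lemma card_permutes_hitting:
  assumes "finite B"
  shows "card {\<pi>. \<pi> permutes {..n} \<and> (\<exists>i\<le>n. (i, \<pi> i) \<in> B)} \<le> card B * fact n"
proof -
  have one: "card {\<pi>. \<pi> permutes {..n} \<and> i \<le> n \<and> \<pi> i = j} \<le> fact n" for i j
  proof (cases "i \<le> n \<and> j \<le> n")
    case True
    \<comment> \<open>Composition with this transposition makes \<open>i\<close> a fixed point,
      leaving a permutation of the other \<open>n\<close> points.\<close>
    let ?t = "Transposition.transpose i j"
    have "card {\<pi>. \<pi> permutes {..n} \<and> i \<le> n \<and> \<pi> i = j} \<le> card {\<pi>. \<pi> permutes ({..n} - {i})}"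
    proof (rule card_inj_on_le[where f = "\<lambda>\<pi>. ?t \<circ> \<pi>"])
      show "inj_on ((\<circ>) ?t) {\<pi>. \<pi> permutes {..n} \<and> i \<le> n \<and> \<pi> i = j}"
        by (intro inj_onI) (metis comp_assoc id_comp transpose_comp_involutory)
      show "(\<circ>) ?t ` {\<pi>. \<pi> permutes {..n} \<and> i \<le> n \<and> \<pi> i = j} \<subseteq> {\<pi>. \<pi> permutes ({..n} - {i})}"
      proof clarsimp
        fix \<pi> assume \<pi>: "\<pi> permutes {..n}" "j = \<pi> i"
        have "?t \<circ> \<pi> permutes {..n}"
          using True \<pi> by (intro permutes_compose permutes_swap_id) auto
        then show "Transposition.transpose i (\<pi> i) \<circ> \<pi> permutes ({..n} - {i})"
          unfolding \<pi>(2) by (rule permutes_superset) auto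
      qed
    qed (simp add: finite_permutations)
    also have "\<dots> = fact n"
      using True by (subst card_permutations[where n = n]) auto
    finally show ?thesis .
  next
    case False
    then have "{\<pi>. \<pi> permutes {..n} \<and> i \<le> n \<and> \<pi> i = j} = {}"
      using permutes_in_image by fastforce
    then show ?thesis by (simp only: card.empty)
  qed
  have "{\<pi>. \<pi> permutes {..n} \<and> (\<exists>i\<le>n. (i, \<pi> i) \<in> B)} =
      (\<Union>(i, j)\<in>B. {\<pi>. \<pi> permutes {..n} \<and> i \<le> n \<and> \<pi> i = j})" by auto
  then have "card {\<pi>. \<pi> permutes {..n} \<and> (\<exists>i\<le>n. (i, \<pi> i) \<in> B)} \<le>
      (\<Sum>(i, j)\<in>B. card {\<pi>. \<pi> permutes {..n} \<and> i \<le> n \<and> \<pi> i = j})"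
    using card_UN_le[OF assms, of "\<lambda>(i, j). {\<pi>. \<pi> permutes {..n} \<and> i \<le> n \<and> \<pi> i = j}"]
    by (simp add: case_prod_beta)
  also have "\<dots> \<le> (\<Sum>(i, j)\<in>B. fact n)"
    using one by (intro sum_mono) auto
  finally show ?thesis by (simp add: case_prod_beta)
qed

lemma card_not_north_south:
  assumes "size S = n" "size R = n" "uncovered S R \<le> K" "uncovered R S \<le> K"
  shows "card {\<pi>. \<pi> permutes {..n} \<and> \<not> north_south (diagram_map (S, R, \<pi>))} \<le> (4 * K + 4) * fact n"
proof -
  obtain u where u: "u \<le> size S" "card {j. j \<le> size R \<and> \<not> leaf_within R j S u} \<le> uncovered S R"
    using exists_covering_leaf by blast
  obtain v where v: "v \<le> size R" "card {i. i \<le> size S \<and> \<not> leaf_within S i R v} \<le> uncovered R S"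
    using exists_covering_leaf by blast
  have "card {\<pi>. \<pi> permutes {..n} \<and> \<not> north_south (diagram_map (S, R, \<pi>))} \<le>
      card {\<pi>. \<pi> permutes {..n} \<and> (\<exists>i\<le>n. (i, \<pi> i) \<in> bad_pairs S R u v)}"
  proof (rule card_mono)
    show "finite {\<pi>. \<pi> permutes {..n} \<and> (\<exists>i\<le>n. (i, \<pi> i) \<in> bad_pairs S R u v)}"
      by (rule finite_subset[OF _ finite_permutations[of "{..n}"]]) auto
  qed (use north_south_if_no_bad_pair[of S R _ n u v] u v assms in \<open>auto simp: diagrams_def\<close>)
  also have "\<dots> \<le> card (bad_pairs S R u v) * fact n"
    by (intro card_permutes_hitting finite_bad_pairs)
  also have "\<dots> \<le> (4 * K + 4) * fact n"
    using card_bad_pairs[of u S v R K] u v assms by (intro mult_right_mono) auto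
  finally show ?thesis .
qed

section \<open>Bounds for the fraction and its limit\<close>

lemma north_south_fraction_le_1: "north_south_fraction n \<le> 1"
proof -
  have "card {D \<in> diagrams n. north_south (diagram_map D)} \<le> card (diagrams n)"
    by (intro card_mono finite_diagrams) auto
  then show ?thesis by (simp add: north_south_fraction_def divide_le_eq)
qed

text \<open>The loss \<open>2 * \<epsilon>\<close> comes from tree pairs with
  \<open>uncovered\<close> above \<open>K\<close> in one of the two orders. Every other pair loses
  at most \<open>(4 * K + 4) * fact n\<close> of its \<open>fact (Suc n)\<close> bijections.\<close>

lemma north_south_fraction_ge:
  assumes K: "\<And>m n. real (card {(S, R). size S = m \<and> size R = n \<and> uncovered S R > K})
    \<le> \<epsilon> * catalan m * catalan n"
  shows "north_south_fraction n \<ge> 1 - 2 * \<epsilon> - (4 * real K + 4) * inverse (real (Suc n))"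
proof -
  define P where "P = {(S, R). size S = n \<and> size R = n \<and> uncovered S R > K}"
  define Q where "Q = {(S, R). size S = n \<and> size R = n \<and> uncovered R S > K}"
  define N where "N = {D \<in> diagrams n. \<not> north_south (diagram_map D)}"
  define c where "c S R = card {\<pi>. \<pi> permutes {..n} \<and> \<not> north_south (diagram_map (S, R, \<pi>))}" for S R
  have T2: "finite (trees n \<times> trees n)" by (simp add: finite_trees)
  have fin: "finite P" "finite Q"
    by (rule finite_subset[OF _ T2], force simp: P_def Q_def)+
  have "Q = prod.swap ` P" by (auto simp: P_def Q_def)
  then have "card Q = card P" by (simp add: card_image)
  moreover have "real (card P) \<le> \<epsilon> * catalan n * catalan n" unfolding P_def by (rule K)
  moreover have "card (P \<union> Q) \<le> card P + card Q" by (rule card_Un_le)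
  ultimately have PQ: "real (card (P \<union> Q)) \<le> 2 * \<epsilon> * (catalan n)\<^sup>2"
    by (simp add: power2_eq_square)
  have c_le: "c S R \<le> fact (Suc n)" for S R
  proof -
    have "c S R \<le> card {\<pi>. \<pi> permutes {..n}}"
      unfolding c_def by (intro card_mono finite_permutations) auto
    then show ?thesis by (subst (asm) card_permutations[OF refl]) auto
  qed
  have "card N = (\<Sum>(S, R)\<in>trees n \<times> trees n. c S R)"
  proof -
    have "N = (SIGMA S:trees n. SIGMA R:trees n.
        {\<pi>. \<pi> permutes {..n} \<and> \<not> north_south (diagram_map (S, R, \<pi>))})"
      by (auto simp: N_def diagrams_def)
    then show ?thesis
      by (simp add: finite_trees finite_permutations c_def sum.cartesian_product finite_SigmaI)
  qed
  also have "\<dots> \<le> (\<Sum>x\<in>trees n \<times> trees n.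
      (if x \<in> P \<union> Q then fact (Suc n) else 0) + (4 * K + 4) * fact n)"
  proof (rule sum_mono)
    fix x assume x: "x \<in> trees n \<times> trees n"
    obtain S R where SR: "x = (S, R)" by (cases x)
    show "(case x of (S, R) \<Rightarrow> c S R) \<le>
        (if x \<in> P \<union> Q then fact (Suc n) else 0) + (4 * K + 4) * fact n"
    proof (cases "x \<in> P \<union> Q")
      case True
      then show ?thesis using c_le[of S R] SR by (simp del: fact_Suc)
    next
      case False
      then show ?thesis
        using card_not_north_south[of S n R K] x SR by (auto simp: P_def Q_def c_def not_less)
    qed
  qed
  also have "\<dots> = card (P \<union> Q) * fact (Suc n) + card (trees n) ^ 2 * ((4 * K + 4) * fact n)"
  proof -
    have "(trees n \<times> trees n) \<inter> (P \<union> Q) = P \<union> Q" by (auto simp: P_def Q_def)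
    then have "(\<Sum>x\<in>trees n \<times> trees n. if x \<in> P \<union> Q then fact (Suc n) else (0 :: nat)) =
        card (P \<union> Q) * fact (Suc n)"
      using sum.inter_restrict[OF T2, of "\<lambda>_. fact (Suc n) :: nat" "P \<union> Q"]
      by (simp only: sum_constant of_nat_id)
    then show ?thesis
      by (simp only: sum.distrib sum_constant of_nat_id card_cartesian_product power2_eq_square)
  qed
  finally have "card N \<le> card (P \<union> Q) * fact (Suc n) + card (trees n) ^ 2 * ((4 * K + 4) * fact n)" .
  then have "real (card N) \<le>
      real (card (P \<union> Q) * fact (Suc n) + card (trees n) ^ 2 * ((4 * K + 4) * fact n))"
    by (rule of_nat_mono)
  also have "\<dots> = real (card (P \<union> Q)) * fact (Suc n) + (catalan n)\<^sup>2 * ((4 * real K + 4) * fact n)"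
    unfolding catalan_def by (simp del: fact_Suc)
  also have "\<dots> \<le> 2 * \<epsilon> * (catalan n)\<^sup>2 * fact (Suc n) + (catalan n)\<^sup>2 * ((4 * real K + 4) * fact n)"
    using PQ by (intro add_mono mult_right_mono) auto
  also have "\<dots> = (2 * \<epsilon> + (4 * real K + 4) * inverse (real (Suc n))) * real (card (diagrams n))"
  proof -
    have "(fact n :: real) = inverse (real (Suc n)) * fact (Suc n)" by simp
    then show ?thesis
      by (simp only: card_diagrams catalan_def Suc_eq_plus1[symmetric] of_nat_mult of_nat_power of_nat_fact)
        (simp only: algebra_simps)
  qed
  finally have N: "real (card N) / real (card (diagrams n)) \<le>
      2 * \<epsilon> + (4 * real K + 4) * inverse (real (Suc n))"
    using catalan_pos[of n] by (simp add: divide_le_eq card_diagrams catalan_def del: fact_Suc)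
  have "card {D \<in> diagrams n. north_south (diagram_map D)} + card N = card (diagrams n)"
    unfolding N_def by (subst card_Un_disjoint[symmetric])
      (auto simp: finite_diagrams intro!: arg_cong[where f = card])
  then have "real (card {D \<in> diagrams n. north_south (diagram_map D)}) =
      real (card (diagrams n)) - real (card N)" by simp
  moreover have "card (diagrams n) > 0"
    using catalan_pos[of n] by (simp add: card_diagrams catalan_def)
  ultimately show ?thesis using N by (simp add: north_south_fraction_def diff_divide_distrib)
qed

theorem theorem2:
  shows "\<exists>L>0. north_south_fraction \<longlonglongrightarrow> L"
proof (intro exI[of _ 1] conjI)
  show "north_south_fraction \<longlonglongrightarrow> 1"
  proof (rule order_tendstoI)
    fix y :: real assume "1 < y"
    then show "eventually (\<lambda>n. north_south_fraction n < y) sequentially"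
      using le_less_trans[OF north_south_fraction_le_1] by simp
  next
    fix y :: real assume y: "y < 1"
    \<comment> \<open>With this value of \<open>\<epsilon>\<close> the lower bound tends to
      \<open>(1 + y) / 2\<close>, which exceeds \<open>y\<close>.\<close>
    obtain K where K: "\<And>m n. real (card {(S, R). size S = m \<and> size R = n \<and> uncovered S R > K})
        \<le> (1 - y) / 4 * catalan m * catalan n"
      using card_uncovered_pairs[of "(1 - y) / 4"] y by auto
    have "(\<lambda>n. 1 - 2 * ((1 - y) / 4) - (4 * real K + 4) * inverse (real (Suc n))) \<longlonglongrightarrow>
        1 - 2 * ((1 - y) / 4) - (4 * real K + 4) * 0"
      by (intro tendsto_intros LIMSEQ_inverse_real_of_nat)
    then have "eventually (\<lambda>n. y < 1 - 2 * ((1 - y) / 4) -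
        (4 * real K + 4) * inverse (real (Suc n))) sequentially"
      using y by (elim order_tendstoD) (simp add: field_simps)
    then show "eventually (\<lambda>n. y < north_south_fraction n) sequentially"
      by eventually_elim (use north_south_fraction_ge[OF K] in \<open>fastforce intro: less_le_trans\<close>)
  qed
qed simp

end
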